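(* All edges of a network can generically be identified from the set $\mathcal{C}$ of measured nodes if and only if $b_{N_i^+\to\mathcal{C}} = d_i^+$ for every node $i$, where $N_i^+$ is the set of out-neighbors of $i$ and $d_i^+=|N_i^+|$.
   Context: Network. There are $L$ nodes with signals $w(t)=[w_1(t),\dots,w_L(t)]^T$ obeying $w(t)=G^0(q)w(t)+r(t)+v(t)$, where $q^{-1}$ is the delay operator, $r(t)$ is a vector of known external excitation signals (one at each node), $v(t)$ is a noise vector, and the network matrix $G^0$ is an $L\times L$ matrix with zero diagonal whose entries are proper rational transfer functions; the network is well-posed ($(I-G^0)^{-1}$ is proper and stable). $T^0=(I-G^0)^{-1}$. Topology. The topology is a known weakly connected directed graph on $\{1,\dots,L\}$ without self-loops; an edge $(j,i)$ from $j$ to $i$ corresponds to a transfer function $G_{ij}$ that is not known to be zero. A matrix $M$ is consistent with the graph if $M_{ij}\neq 0$ only if $(j,i)$ is an edge (an edge does not force $M_{ij}\ne0$). $G^0$ is consistent with its graph. $N_i^+$ is the set of nodes $j$ such that $(i,j)$ is an edge. Measurements. $y(t)=Cw(t)$, where $C$ is a $p\times L$ matrix each row of which has one entry $1$ and all others $0$; $\mathcal{C}$ is the set of $p$ nodes selected by $C$. The matrix $CT^0$ is assumed exactly known. Generic identifiability. A rational transfer matrix parametrization consistent with the graph: for every edge $(j,i)$ fix nonnegative integers $p_{ij},n_{ij}$ and set $$G_{ij}(z)=\kappa_{ij}z^{-p_{ij}}\frac{z^{n_{ij}}+\beta_{ij}^{(n_{ij}-1)}z^{n_{ij}-1}+\dots+\beta_{ij}^{(0)}}{z^{n_{ij}}+\alpha_{ij}^{(n_{ij}-1)}z^{n_{ij}-1}+\dots+\alpha_{ij}^{(0)}}$$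 with real parameters $\kappa_{ij},\alpha_{ij}^{(m)},\beta_{ij}^{(m)}$, and $G_{ij}(z)=0$ when $(j,i)$ is not an edge. All parameters are collected in $P\in\mathbb{R}^N$, and the resulting matrix is $G(P,z)$. All edges of the network (equivalently, the network matrix) can generically be identified from $\mathcal{C}$ if for every such parametrization, for all $P$ except possibly those in a zero-measure subset of $\mathbb{R}^N$, the following holds: for every network matrix $\tilde G(z)$ consistent with the graph, $C(I-G(P,z))^{-1}=C(I-\tilde G(z))^{-1}$ implies $G(P,z)=\tilde G(z)$. Paths. A walk is a sequence of adjacent directed edges (including trivial walks consisting of one node and no edge). A path is a walk that never passes twice through the same node. Paths are mutually vertex disjoint if no two of them contain a common vertex (including start and end vertices). For sets of nodes $\mathcal{A},\mathcal{C}$, $b_{\mathcal{A}\to\mathcal{C}}$ is the maximum number of mutually vertex disjoint paths starting in $\mathcal{A}$ and ending in $\mathcal{C}$. *)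

theory Defs
  imports
    "HOL-Analysis.Lebesgue_Measure"
    "HOL-Computational_Algebra.Polynomial"
    "HOL-Computational_Algebra.Fraction_Field"
    "Jordan_Normal_Form.Gauss_Jordan_Elimination"
    "Graph_Theory.Digraph_Component"
begin

text \<open>
  Nodes are \<open>0, \<dots>, L - 1\<close>. A topology is a \<^typ>\<open>nat pair_pre_digraph\<close>; its arc \<open>(j, i)\<close> goes
  from \<open>j\<close> to \<open>i\<close> and corresponds to the matrix entry in row \<open>i\<close> and column \<open>j\<close>.
\<close>

definition network_graph :: "nat \<Rightarrow> nat pair_pre_digraph \<Rightarrow> bool" where
  "network_graph L D \<longleftrightarrow>
     pair_digraph D \<and> pverts D = {..<L} \<and> Digraph_Component.connected (with_proj D)"

definition out_neighbors :: "nat pair_pre_digraph \<Rightarrow> nat \<Rightarrow> nat set" where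
  "out_neighbors D i = {j. (i, j) \<in> parcs D}"


type_synonym ratfun = "real poly fract"

definition proper :: "ratfun \<Rightarrow> bool" where
  "proper f \<longleftrightarrow> (\<exists>a b. b \<noteq> 0 \<and> f = Fract a b \<and> degree a \<le> degree b)"

text \<open>Discrete time, with \<open>q = z\<close> the forward shift: the poles, that is, the complex roots of the
  denominator in lowest terms, must lie in the open unit disk.\<close>

definition stable :: "ratfun \<Rightarrow> bool" where
  "stable f \<longleftrightarrow>
     (\<exists>a b. b \<noteq> 0 \<and> coprime a b \<and> f = Fract a b \<and>
       (\<forall>z :: complex. poly (map_poly complex_of_real b) z = 0 \<longrightarrow> cmod z < 1))"

text \<open>The matrix \<open>T = (I - G)\<^sup>-\<^sup>1\<close>.\<close>

definition closed_loop :: "ratfun mat \<Rightarrow> ratfun mat" where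
  "closed_loop G = the (mat_inverse (1\<^sub>m (dim_row G) - G))"

definition well_posed :: "ratfun mat \<Rightarrow> bool" where
  "well_posed G \<longleftrightarrow>
     invertible_mat (1\<^sub>m (dim_row G) - G) \<and>
     (\<forall>x \<in> elements_mat (closed_loop G). proper x \<and> stable x)"

definition network_matrix :: "nat \<Rightarrow> ratfun mat \<Rightarrow> bool" where
  "network_matrix L G \<longleftrightarrow>
     G \<in> carrier_mat L L \<and> (\<forall>i < L. G $$ (i, i) = 0) \<and>
     (\<forall>x \<in> elements_mat G. proper x) \<and> well_posed G"

definition consistent :: "nat pair_pre_digraph \<Rightarrow> ratfun mat \<Rightarrow> bool" where
  "consistent D G \<longleftrightarrow>
     (\<forall>i < dim_row G. \<forall>j < dim_col G. G $$ (i, j) \<noteq> 0 \<longrightarrow> (j, i) \<in> parcs D)"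


definition selection_matrix :: "nat \<Rightarrow> nat \<Rightarrow> ratfun mat \<Rightarrow> bool" where
  "selection_matrix p L C \<longleftrightarrow>
     C \<in> carrier_mat p L \<and> (\<forall>r < p. \<exists>c < L. row C r = unit_vec L c)"

definition measured_nodes :: "ratfun mat \<Rightarrow> nat set" where
  "measured_nodes C = {c. c < dim_col C \<and> (\<exists>r < dim_row C. C $$ (r, c) = 1)}"


text \<open>
  The parameters of the entries \<open>G\<^sub>i\<^sub>j\<close>, for a choice of degrees \<open>n i j\<close> and delays \<open>d i j\<close>
  (\<open>p\<^sub>i\<^sub>j\<close> in the power \<open>z\<^sup>-\<^sup>p\<close>). The parameter space
  \<open>\<real>\<^sup>N\<close> has one coordinate for each element of \<open>param_set D n\<close>.
\<close>

datatype param = Kappa nat nat | Alpha nat nat nat | Beta nat nat nat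

definition param_set :: "nat pair_pre_digraph \<Rightarrow> (nat \<Rightarrow> nat \<Rightarrow> nat) \<Rightarrow> param set" where
  "param_set D n =
     {Kappa i j | i j. (j, i) \<in> parcs D} \<union>
     {Alpha i j m | i j m. (j, i) \<in> parcs D \<and> m < n i j} \<union>
     {Beta i j m | i j m. (j, i) \<in> parcs D \<and> m < n i j}"

definition monic_poly :: "nat \<Rightarrow> (nat \<Rightarrow> real) \<Rightarrow> real poly" where
  "monic_poly n c = monom 1 n + (\<Sum>m < n. monom (c m) m)"

definition param_entry ::
    "(nat \<Rightarrow> nat \<Rightarrow> nat) \<Rightarrow> (nat \<Rightarrow> nat \<Rightarrow> nat) \<Rightarrow> (param \<Rightarrow> real) \<Rightarrow> nat \<Rightarrow> nat \<Rightarrow> ratfun" where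
  "param_entry d n P i j =
     Fract (Polynomial.smult (P (Kappa i j)) (monic_poly (n i j) (\<lambda>m. P (Beta i j m))))
           (monom 1 (d i j) * monic_poly (n i j) (\<lambda>m. P (Alpha i j m)))"

definition param_matrix ::
    "nat \<Rightarrow> nat pair_pre_digraph \<Rightarrow> (nat \<Rightarrow> nat \<Rightarrow> nat) \<Rightarrow> (nat \<Rightarrow> nat \<Rightarrow> nat) \<Rightarrow>
      (param \<Rightarrow> real) \<Rightarrow> ratfun mat" where
  "param_matrix L D d n P =
     mat L L (\<lambda>(i, j). if (j, i) \<in> parcs D then param_entry d n P i j else 0)"

text \<open>
  For almost every parameter vector the inverse of
  \<open>I - G(P, z)\<close> exists (its determinant is nonzero when all \<open>\<kappa>\<^sub>i\<^sub>j\<close> vanish), so the value of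
  \<^const>\<open>closed_loop\<close> in the singular case is irrelevant.
\<close>

definition generically_identifiable ::
    "nat \<Rightarrow> nat pair_pre_digraph \<Rightarrow> ratfun mat \<Rightarrow> bool" where
  "generically_identifiable L D C \<longleftrightarrow>
     (\<forall>d n. AE P in (\<Pi>\<^sub>M x \<in> param_set D n. lborel).
        \<forall>G. network_matrix L G \<and> consistent D G \<longrightarrow>
          C * closed_loop (param_matrix L D d n P) = C * closed_loop G \<longrightarrow>
          param_matrix L D d n P = G)"


text \<open>A path is given by its first node and its list of arcs, empty for a trivial path.\<close>

definition disjoint_paths ::
    "nat pair_pre_digraph \<Rightarrow> nat set \<Rightarrow> nat set \<Rightarrow> (nat \<times> (nat \<times> nat) awalk) set \<Rightarrow> bool" where
  "disjoint_paths D A B Q \<longleftrightarrow>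
     (\<forall>(u, p) \<in> Q. u \<in> A \<and> (\<exists>v \<in> B. pre_digraph.apath (with_proj D) u p v)) \<and>
     pairwise (\<lambda>(u, p) (u', p'). disjnt (set (pawalk_verts u p)) (set (pawalk_verts u' p'))) Q"

definition max_disjoint_paths :: "nat pair_pre_digraph \<Rightarrow> nat set \<Rightarrow> nat set \<Rightarrow> nat" where
  "max_disjoint_paths D A B = Max {card Q | Q. finite Q \<and> disjoint_paths D A B Q}"

end

theory Submission
  imports
    Defs
    "Jordan_Normal_Form.Char_Poly"
    "HOL-Computational_Algebra.Field_as_Ring"
    "HOL-Computational_Algebra.Polynomial_Factorial"
begin

text \<open>
  With \<open>V\<close> the nodes, \<open>B\<close> the measured nodes and \<open>x = T \<delta>\<close>, a change \<open>\<delta>\<close> of column \<open>i\<close> of \<open>G\<close> that is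
  supported on \<open>N = N\<^sub>i\<^sup>+\<close> is invisible in \<open>C T\<close> iff \<open>x\<close> vanishes on \<open>B\<close> and \<open>(I - G) x\<close> vanishes
  outside \<open>N\<close>. So column \<open>i\<close> is determined iff the submatrix of \<open>I - G\<close> with rows \<open>V - N\<close> and columns
  \<open>V - B\<close> has trivial kernel. A trivial kernel forces a nonzero transversal, that is, an injection
  \<open>\<tau>\<close> from \<open>V - B\<close> to \<open>V - N\<close> with \<open>\<tau> u = u\<close> or \<open>(u, \<tau> u)\<close> an arc; its iterates starting in \<open>N\<close> are
  \<open>|N|\<close> vertex-disjoint paths to \<open>B\<close>. Conversely the paths give \<open>\<tau>\<close>, and the minor of the rows \<open>\<tau> u\<close>
  is nonzero for one parameter vector, hence for almost all. This avoids Menger's theorem.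
\<close>

section \<open>Generic nonvanishing\<close>

text \<open>Polynomial functions of the parameter vector, generated semantically: rule induction
  then yields measurability, one-variable slices and substitution without any calculus of
  monomials.\<close>

inductive polyfun :: "(('i \<Rightarrow> real) \<Rightarrow> real) \<Rightarrow> bool" where
  polyfun_const: "polyfun (\<lambda>_. c)"
| polyfun_coord: "polyfun (\<lambda>P. P x)"
| polyfun_add: "polyfun f \<Longrightarrow> polyfun g \<Longrightarrow> polyfun (\<lambda>P. f P + g P)"
| polyfun_mult: "polyfun f \<Longrightarrow> polyfun g \<Longrightarrow> polyfun (\<lambda>P. f P * g P)"

lemma polyfun_sum: "(\<And>a. a \<in> A \<Longrightarrow> polyfun (f a)) \<Longrightarrow> polyfun (\<lambda>P. \<Sum>a\<in>A. f a P)"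
  by (induction A rule: infinite_finite_induct) (auto intro: polyfun.intros)

lemma polyfun_borel_measurable:
  assumes "polyfun f"
  shows "f \<in> borel_measurable (\<Pi>\<^sub>M x \<in> I. lborel)"
  using assms
proof induction
  case (polyfun_coord x)
  show ?case
  proof (cases "x \<in> I")
    case False
    \<comment> \<open>On the product space a coordinate outside \<open>I\<close> is constantly
      \<open>undefined\<close>.\<close>
    let ?M = "\<Pi>\<^sub>M x \<in> I. (lborel :: real measure)"
    have "(\<lambda>P. P x) \<in> borel_measurable ?M \<longleftrightarrow> (\<lambda>_. undefined :: real) \<in> borel_measurable ?M"
      using False by (intro measurable_cong) (auto simp: space_PiM PiE_def extensional_def)
    then show ?thesis by simp
  qed simp
qed auto

lemma polyfun_slice: "polyfun f \<Longrightarrow> \<exists>q. \<forall>t. f (P(x := t)) = poly q t"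
proof (induction rule: polyfun.induct)
  case (polyfun_const c)
  show ?case by (rule exI[of _ "[:c:]"]) simp
next
  case (polyfun_coord y)
  show ?case
    by (cases "y = x") (auto intro: exI[of _ "[:0, 1:]"] exI[of _ "[:P y:]"])
next
  case (polyfun_add f g)
  then show ?case by (metis poly_add)
next
  case (polyfun_mult f g)
  then show ?case by (metis poly_mult)
qed

lemma polyfun_fun_upd: "polyfun f \<Longrightarrow> polyfun (\<lambda>P. f (P(x := t)))"
proof (induction rule: polyfun.induct)
  case (polyfun_coord y)
  then show ?case by (cases "y = x") (auto intro: polyfun.intros)
qed (auto intro: polyfun.intros)

text \<open>Fubini and induction over the coordinates. The slice through \<open>P0\<close> in
  direction \<open>x\<close> is a nonzero polynomial in one variable, so all but finitely many
  values \<open>t\<close> leave a function of the remaining coordinates that is still nonzero at the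
  witness.\<close>

lemma AE_polyfun_nonzero:
  assumes "finite I" "polyfun f" "P0 \<in> extensional I" "f P0 \<noteq> 0"
  shows "AE P in (\<Pi>\<^sub>M x \<in> I. lborel). f P \<noteq> 0"
  using assms
proof (induction I arbitrary: f P0 rule: finite_induct)
  case empty
  then show ?case by (auto simp: PiM_empty AE_count_space extensional_def)
next
  case (insert x I)
  interpret product_sigma_finite "\<lambda>_. lborel :: real measure" ..
  let ?M = "\<lambda>I. \<Pi>\<^sub>M x \<in> I. (lborel :: real measure)"
  \<comment> \<open>The induction hypothesis wants a witness that is extensional on
    \<open>I\<close>, so \<open>x\<close> is reset; \<open>q\<close> still describes the slice
    through \<open>P0\<close>.\<close>
  let ?P = "P0(x := undefined)"
  have f [measurable]: "f \<in> borel_measurable (?M (insert x I))"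
    by (rule polyfun_borel_measurable) fact
  obtain q where q: "\<And>t. f (?P(x := t)) = poly q t"
    using polyfun_slice[OF insert.prems(1)] by blast
  have "q \<noteq> 0"
    using q[of "P0 x"] insert.prems by auto
  then have "AE t in lborel. poly q t \<noteq> 0"
    by (intro AE_I'[of "{t. poly q t = 0}"])
      (auto intro!: finite_imp_null_set_lborel poly_roots_finite)
  moreover have "AE P in ?M I. f (P(x := t)) \<noteq> 0" if "poly q t \<noteq> 0" for t
  proof (rule insert.IH)
    show "?P \<in> extensional I" using insert.prems by (auto simp: extensional_def)
    show "polyfun (\<lambda>P. f (P(x := t)))" using insert.prems(1) by (rule polyfun_fun_upd)
    show "f (?P(x := t)) \<noteq> 0" using that unfolding q .
  qed
  ultimately have ae: "AE t in lborel. AE P in ?M I. f (P(x := t)) \<noteq> 0" by auto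
  let ?Z = "{P \<in> space (?M (insert x I)). f P = 0}"
  have "emeasure (?M (insert x I)) ?Z = (\<integral>\<^sup>+ P. indicator ?Z P \<partial>?M (insert x I))"
    by simp
  also have "\<dots> = (\<integral>\<^sup>+ t. (\<integral>\<^sup>+ P. indicator ?Z (P(x := t)) \<partial>?M I) \<partial>lborel)"
    using insert.hyps by (subst product_nn_integral_insert_rev) auto
  also have "\<dots> = (\<integral>\<^sup>+ t. 0 \<partial>(lborel :: real measure))"
  proof (rule nn_integral_cong_AE, use ae in eventually_elim)
    case (elim t)
    have "(\<integral>\<^sup>+ P. indicator ?Z (P(x := t)) \<partial>?M I) = (\<integral>\<^sup>+ P. 0 \<partial>?M I)"
      by (rule nn_integral_cong_AE, use elim in eventually_elim) (simp add: indicator_def)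
    then show ?case by simp
  qed
  finally have "?Z \<in> null_sets (?M (insert x I))" by (simp add: null_sets_def)
  then show ?case by (rule AE_I') auto
qed

text \<open>The condition concerns values at each fixed real \<open>z\<close>, so that a nonzero
  numerator can be detected at a single \<open>z\<close>. A denominator that is a nonzero polynomial
  for every parameter vector keeps sums and products free of case distinctions.\<close>

definition rational_in_params :: "((param \<Rightarrow> real) \<Rightarrow> ratfun) \<Rightarrow> bool" where
  "rational_in_params f \<longleftrightarrow> (\<exists>A B. (\<forall>P. B P \<noteq> 0) \<and> (\<forall>P. f P = Fract (A P) (B P)) \<and>
     (\<forall>z. polyfun (\<lambda>P. poly (A P) z)) \<and> (\<forall>z. polyfun (\<lambda>P. poly (B P) z)))"

lemma rational_in_paramsI:
  assumes "\<And>P. B P \<noteq> 0" "\<And>P. f P = Fract (A P) (B P)"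
    and "\<And>z. polyfun (\<lambda>P. poly (A P) z)" "\<And>z. polyfun (\<lambda>P. poly (B P) z)"
  shows "rational_in_params f"
  unfolding rational_in_params_def using assms by blast

lemma rational_in_params_const: "rational_in_params (\<lambda>_. c)"
proof -
  obtain a b where "c = Fract a b" "b \<noteq> 0" by (cases c)
  then show ?thesis
    by (intro rational_in_paramsI[of "\<lambda>_. b" _ "\<lambda>_. a"]) (auto intro: polyfun_const)
qed

lemma rational_in_params_add:
  assumes "rational_in_params f" "rational_in_params g"
  shows "rational_in_params (\<lambda>P. f P + g P)"
proof -
  obtain A B where f: "\<And>P. B P \<noteq> 0" "\<And>P. f P = Fract (A P) (B P)"
      "\<And>z. polyfun (\<lambda>P. poly (A P) z)" "\<And>z. polyfun (\<lambda>P. poly (B P) z)"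
    using assms(1) unfolding rational_in_params_def by blast
  obtain A' B' where g: "\<And>P. B' P \<noteq> 0" "\<And>P. g P = Fract (A' P) (B' P)"
      "\<And>z. polyfun (\<lambda>P. poly (A' P) z)" "\<And>z. polyfun (\<lambda>P. poly (B' P) z)"
    using assms(2) unfolding rational_in_params_def by blast
  show ?thesis
    by (rule rational_in_paramsI[of "\<lambda>P. B P * B' P" _ "\<lambda>P. A P * B' P + A' P * B P"])
      (auto simp: f g intro!: polyfun.intros)
qed

lemma rational_in_params_mult:
  assumes "rational_in_params f" "rational_in_params g"
  shows "rational_in_params (\<lambda>P. f P * g P)"
proof -
  obtain A B where f: "\<And>P. B P \<noteq> 0" "\<And>P. f P = Fract (A P) (B P)"
      "\<And>z. polyfun (\<lambda>P. poly (A P) z)" "\<And>z. polyfun (\<lambda>P. poly (B P) z)"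
    using assms(1) unfolding rational_in_params_def by blast
  obtain A' B' where g: "\<And>P. B' P \<noteq> 0" "\<And>P. g P = Fract (A' P) (B' P)"
      "\<And>z. polyfun (\<lambda>P. poly (A' P) z)" "\<And>z. polyfun (\<lambda>P. poly (B' P) z)"
    using assms(2) unfolding rational_in_params_def by blast
  show ?thesis
    by (rule rational_in_paramsI[of "\<lambda>P. B P * B' P" _ "\<lambda>P. A P * A' P"])
      (auto simp: f g intro!: polyfun.intros)
qed

lemma rational_in_params_sum:
  "(\<And>a. a \<in> S \<Longrightarrow> rational_in_params (f a)) \<Longrightarrow> rational_in_params (\<lambda>P. \<Sum>a\<in>S. f a P)"
  by (induction S rule: infinite_finite_induct)
    (auto intro: rational_in_params_const rational_in_params_add)

lemma rational_in_params_prod: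
  "(\<And>a. a \<in> S \<Longrightarrow> rational_in_params (f a)) \<Longrightarrow> rational_in_params (\<lambda>P. \<Prod>a\<in>S. f a P)"
  by (induction S rule: infinite_finite_induct)
    (auto intro: rational_in_params_const rational_in_params_mult)

lemma rational_in_params_det:
  assumes "\<And>P. A P \<in> carrier_mat n n"
    and "\<And>i j. i < n \<Longrightarrow> j < n \<Longrightarrow> rational_in_params (\<lambda>P. A P $$ (i, j))"
  shows "rational_in_params (\<lambda>P. det (A P))"
proof -
  have "det (A P) = (\<Sum>p | p permutes {0..<n}. signof p * (\<Prod>i = 0..<n. A P $$ (i, p i)))" for P
    by (rule det_def') (rule assms)
  moreover have "p i < n" if "p permutes {0..<n}" "i < n" for p i
    using permutes_in_image[OF that(1), of i] that(2) by simp
  ultimately show ?thesis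
    by (auto intro!: rational_in_params_sum rational_in_params_mult rational_in_params_const
        rational_in_params_prod assms)
qed

text \<open>The numerator at \<open>P0\<close> is a nonzero polynomial, hence nonzero at some real
  \<open>z\<close>; with this \<open>z\<close> fixed, its value is a polynomial function of the
  parameters alone.\<close>

lemma AE_rational_in_params_nonzero:
  assumes "finite I" "rational_in_params f" "P0 \<in> extensional I" "f P0 \<noteq> 0"
  shows "AE P in (\<Pi>\<^sub>M x \<in> I. lborel). f P \<noteq> 0"
proof -
  obtain A B where f: "\<And>P. B P \<noteq> 0" "\<And>P. f P = Fract (A P) (B P)"
      "\<And>z. polyfun (\<lambda>P. poly (A P) z)" 
    using assms(2) unfolding rational_in_params_def by blast
  have "A P0 \<noteq> 0" using f(2)[of P0] assms(4) by (auto simp: fract_collapse)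
  then obtain z where "poly (A P0) z \<noteq> 0" using poly_all_0_iff_0 by blast
  then have "AE P in (\<Pi>\<^sub>M x \<in> I. lborel). poly (A P) z \<noteq> 0"
    using assms f(3) by (intro AE_polyfun_nonzero) auto
  then show ?thesis
  proof eventually_elim
    case (elim P)
    then have "A P \<noteq> 0" by auto
    then show ?case using f(1)[of P] by (simp add: f(2) Zero_fract_def eq_fract)
  qed
qed

section \<open>The parametrized entries as functions of the parameters\<close>

lemma monic_poly_nonzero: "monic_poly n c \<noteq> 0"
proof -
  have "coeff (monic_poly n c) n = 1" by (simp add: monic_poly_def coeff_sum)
  then show ?thesis by auto
qed

lemma polyfun_monic_poly:
  assumes "\<And>m. polyfun (\<lambda>P. c P m)"
  shows "polyfun (\<lambda>P. poly (monic_poly n (c P)) z)"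
  unfolding monic_poly_def
  by (auto simp: poly_sum poly_monom intro!: polyfun.intros polyfun_sum assms)

lemma rational_in_params_param_entry: "rational_in_params (\<lambda>P. param_entry d n P i j)"
  by (rule rational_in_paramsI)
    (auto simp: param_entry_def monic_poly_nonzero poly_monom
      intro!: polyfun.intros polyfun_monic_poly)

lemma param_matrix_carrier: "param_matrix L D d n P \<in> carrier_mat L L"
  by (simp add: param_matrix_def)

lemma rational_in_params_param_matrix:
  assumes "i < L" "j < L"
  shows "rational_in_params (\<lambda>P. param_matrix L D d n P $$ (i, j))"
  using assms
  by (cases "(j, i) \<in> parcs D")
    (auto simp: param_matrix_def intro: rational_in_params_param_entry rational_in_params_const)

lemma finite_param_set:
  assumes "finite (parcs D)"
  shows "finite (param_set D n)"
proof -
  have "{Kappa i j |i j. (j, i) \<in> parcs D} = (\<lambda>(j, i). Kappa i j) ` parcs D"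
    "{Alpha i j m |i j m. (j, i) \<in> parcs D \<and> m < n i j} =
      (\<Union>(j, i)\<in>parcs D. Alpha i j ` {..<n i j})"
    "{Beta i j m |i j m. (j, i) \<in> parcs D \<and> m < n i j} =
      (\<Union>(j, i)\<in>parcs D. Beta i j ` {..<n i j})"
    by force+
  then show ?thesis unfolding param_set_def using assms by auto
qed

section \<open>Transversals and the closed loop\<close>

text \<open>Induction on the number of columns. Given \<open>n\<close> rows with a nonzero minor in
  the first \<open>n\<close> columns, the cofactors along a further row form a vector
  \<open>x\<close> whose last entry is that minor. As \<open>x\<close> is nonzero, some row of
  \<open>R\<close> does not annihilate it, and by Laplace expansion this row extends the
  minor.\<close>

lemma exists_nonzero_minor:
  fixes A :: "'r \<Rightarrow> nat \<Rightarrow> 'a :: field"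
  assumes "\<And>x. (\<forall>r\<in>R. (\<Sum>j<n. A r j * x j) = 0) \<Longrightarrow> \<forall>j<n. x j = 0"
  shows "\<exists>f. (\<forall>i<n. f i \<in> R) \<and> det (mat n n (\<lambda>(i, j). A (f i) j)) \<noteq> 0"
  using assms
proof (induction n)
  case 0
  have "det (mat 0 0 (\<lambda>(i, j). A (f i) j)) = 1" for f
    by (rule det_dim_zero) simp
  then show ?case by auto
next
  case (Suc n)
  have "\<forall>j<n. x j = 0" if x: "\<forall>r\<in>R. (\<Sum>j<n. A r j * x j) = 0" for x
  proof -
    \<comment> \<open>Padding with 0 turns a kernel vector of the first \<open>n\<close> columns
      into one of all \<open>Suc n\<close> columns.\<close>
    let ?x = "x(n := 0)"
    have "(\<Sum>j<n. A r j * ?x j) = (\<Sum>j<n. A r j * x j)" for r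
      by (rule sum.cong) auto
    then have "\<forall>r\<in>R. (\<Sum>j<Suc n. A r j * ?x j) = 0" using x by simp
    from Suc.prems[OF this] show ?thesis by (metis fun_upd_other less_SucI less_irrefl)
  qed
  then obtain f where f: "\<forall>i<n. f i \<in> R" "det (mat n n (\<lambda>(i, j). A (f i) j)) \<noteq> 0"
    using Suc.IH by blast
  define M where "M r = mat (Suc n) (Suc n) (\<lambda>(i, j). A ((f(n := r)) i) j)" for r
  define x where
    "x j = (-1) ^ (n + j) * det (mat n n (\<lambda>(i, k). A (f i) (if k < j then k else Suc k)))" for j
  have M: "M r \<in> carrier_mat (Suc n) (Suc n)" for r by (simp add: M_def)
  \<comment> \<open>The cofactors of the last row do not depend on that row.\<close>
  have cof: "cofactor (M r) n j = x j" if "j < Suc n" for r j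
    unfolding cofactor_def x_def mat_delete_def
    by (intro arg_cong2[of _ _ _ _ "(*)"] arg_cong[of _ _ det] eq_matI) (auto simp: M_def)
  have det: "det (M r) = (\<Sum>j<Suc n. A r j * x j)" for r
  proof -
    have "det (M r) = (\<Sum>j<Suc n. M r $$ (n, j) * cofactor (M r) n j)"
      by (rule laplace_expansion_row[OF M]) simp
    also have "\<dots> = (\<Sum>j<Suc n. A r j * x j)"
      by (rule sum.cong) (simp_all add: cof, simp add: M_def)
    finally show ?thesis .
  qed
  have "mat n n (\<lambda>(i, k). A (f i) (if k < n then k else Suc k)) = mat n n (\<lambda>(i, j). A (f i) j)"
    by (rule eq_matI) auto
  then have "x n \<noteq> 0" using f(2) by (simp add: x_def)
  then obtain r where "r \<in> R" "det (M r) \<noteq> 0"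
    using Suc.prems[of x] unfolding det by blast
  moreover have "\<forall>i<Suc n. (f(n := r)) i \<in> R" using f(1) \<open>r \<in> R\<close> by (auto simp: less_Suc_eq)
  ultimately show ?case unfolding M_def by blast
qed

text \<open>A nonzero minor has a nonzero term in its Leibniz expansion; the permutation of that
  term, followed by the choice of rows, is the transversal. The chosen rows are distinct because
  equal rows would make the minor vanish.\<close>

lemma exists_nonzero_transversal:
  fixes A :: "'r \<Rightarrow> nat \<Rightarrow> 'a :: field"
  assumes "\<And>x. (\<forall>r\<in>R. (\<Sum>j<n. A r j * x j) = 0) \<Longrightarrow> \<forall>j<n. x j = 0"
  shows "\<exists>\<sigma>. inj_on \<sigma> {..<n} \<and> (\<forall>j<n. \<sigma> j \<in> R \<and> A (\<sigma> j) j \<noteq> 0)"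
proof -
  obtain f where f: "\<forall>i<n. f i \<in> R" and det: "det (mat n n (\<lambda>(i, j). A (f i) j)) \<noteq> 0"
      (is "det ?M \<noteq> 0")
    using exists_nonzero_minor[OF assms] by blast
  have M: "?M \<in> carrier_mat n n" by simp
  have inj: "inj_on f {..<n}"
  proof (rule inj_onI)
    fix i j assume ij: "i \<in> {..<n}" "j \<in> {..<n}" "f i = f j"
    then have "row ?M i = row ?M j" by (intro eq_vecI) auto
    then show "i = j" using det_identical_rows[OF M, of i j] det ij(1,2) by (metis lessThan_iff)
  qed
  obtain p where p: "p permutes {0..<n}" and nz: "(\<Prod>j<n. ?M $$ (p j, j)) \<noteq> 0"
    using det sum.neutral unfolding det_col[OF M]
    by (smt (verit, ccfv_threshold) mem_Collect_eq mult_zero_right)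
  have lt: "p j < n" if "j < n" for j using permutes_in_image[OF p, of j] that by simp
  show ?thesis
  proof (intro exI[of _ "f \<circ> p"] conjI allI impI)
    have "inj_on p {..<n}" "p ` {..<n} \<subseteq> {..<n}"
      using p lt by (auto intro: permutes_inj_on)
    then show "inj_on (f \<circ> p) {..<n}" using inj by (auto intro: comp_inj_on inj_on_subset)
    fix j assume "j < n"
    then show "(f \<circ> p) j \<in> R" "A ((f \<circ> p) j) j \<noteq> 0" using f lt nz by auto
  qed
qed

section \<open>The closed loop as an inverse matrix\<close>

lemma closed_loop_inverse:
  assumes G: "G \<in> carrier_mat L L" and det: "det (1\<^sub>m L - G) \<noteq> 0"
  shows "closed_loop G \<in> carrier_mat L L"
    and "(1\<^sub>m L - G) * closed_loop G = 1\<^sub>m L"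
    and "closed_loop G * (1\<^sub>m L - G) = 1\<^sub>m L"
proof -
  have A: "1\<^sub>m L - G \<in> carrier_mat L L" using G by auto
  have "mat_inverse (1\<^sub>m L - G) \<noteq> None"
  proof
    assume "mat_inverse (1\<^sub>m L - G) = None"
    from mat_inverse(1)[OF A this, of "()"] det_non_zero_imp_unit[OF A det, of "()"]
    show False by (rule notE)
  qed
  then obtain B where B: "mat_inverse (1\<^sub>m L - G) = Some B" by auto
  then have "closed_loop G = B" using G by (simp add: closed_loop_def)
  then show "closed_loop G \<in> carrier_mat L L" "(1\<^sub>m L - G) * closed_loop G = 1\<^sub>m L"
    "closed_loop G * (1\<^sub>m L - G) = 1\<^sub>m L"
    using mat_inverse(2)[OF A B] by auto
qed

lemma invertible_mat_iff_det:
  fixes A :: "'a :: field mat"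
  assumes A: "A \<in> carrier_mat n n"
  shows "invertible_mat A \<longleftrightarrow> det A \<noteq> 0"
proof
  assume "invertible_mat A"
  then obtain B where B: "A * B = 1\<^sub>m n" "B * A = 1\<^sub>m (dim_row B)"
    using A unfolding invertible_mat_def inverts_mat_def by auto
  have "dim_col (A * B) = n" "dim_col (B * A) = dim_row B" unfolding B by simp_all
  then have "B \<in> carrier_mat n n" using A by auto
  then show "det A \<noteq> 0" using B(1) det_mult[OF A] by force
next
  assume "det A \<noteq> 0"
  from det_non_zero_imp_unit[OF A this, of undefined]
  obtain B where "B \<in> carrier_mat n n" "B * A = 1\<^sub>m n" "A * B = 1\<^sub>m n"
    unfolding Units_def ring_mat_def by auto
  then show "invertible_mat A"
    using A by (auto simp: invertible_mat_def inverts_mat_def)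
qed

lemma closed_loop_eqI:
  assumes G: "G \<in> carrier_mat L L" and T: "T \<in> carrier_mat L L" "T * (1\<^sub>m L - G) = 1\<^sub>m L"
  shows "det (1\<^sub>m L - G) \<noteq> 0" "closed_loop G = T"
proof -
  have A: "1\<^sub>m L - G \<in> carrier_mat L L" using G by auto
  have "det T * det (1\<^sub>m L - G) = 1" using det_mult[OF T(1) A] T(2) by simp
  then show det: "det (1\<^sub>m L - G) \<noteq> 0" by auto
  note cl = closed_loop_inverse[OF G det]
  have "closed_loop G = T * (1\<^sub>m L - G) * closed_loop G" using T cl by simp
  also have "\<dots> = T" using T(1) A cl by (simp add: assoc_mult_mat[of _ L L _ L _ L])
  finally show "closed_loop G = T" .
qed

section \<open>Linkings and disjoint paths\<close>

text \<open>A linking of \<open>D\<close> is the same as a nonzero transversal of the rows outside \<open>N\<close> and the columns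
  outside \<open>B\<close> of \<open>I - G\<close>. Iterating it from the nodes of \<open>N\<close> traces disjoint paths to \<open>B\<close>.\<close>

definition linking :: "'a pair_pre_digraph \<Rightarrow> 'a set \<Rightarrow> 'a set \<Rightarrow> ('a \<Rightarrow> 'a) \<Rightarrow> bool" where
  "linking D N B \<tau> \<longleftrightarrow> inj_on \<tau> (pverts D - B) \<and> \<tau> ` (pverts D - B) \<subseteq> pverts D - N \<and>
     (\<forall>u \<in> pverts D - B. \<tau> u = u \<or> (u, \<tau> u) \<in> parcs D)"

lemma pawalk_verts_map_upt:
  "a \<le> b \<Longrightarrow> pawalk_verts (s a) (map (\<lambda>m. (s m, s (Suc m))) [a..<b]) = map s [a..<Suc b]"
proof (induction a rule: inc_induct)
  case (step a)
  have "[a..<b] = a # [Suc a..<b]" "[a..<Suc b] = a # [Suc a..<Suc b]"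
    using step.hyps by (simp_all only: upt_conv_Cons less_SucI)
  then show ?case using step.IH by simp
qed simp

lemma pcas_map_upt:
  "a \<le> b \<Longrightarrow> pcas (s a) (map (\<lambda>m. (s m, s (Suc m))) [a..<b]) (s b)"
proof (induction a rule: inc_induct)
  case (step a)
  then show ?case by (simp only: upt_conv_Cons) simp
qed simp

text \<open>The paths are the orbits of \<open>\<tau>\<close> from the nodes of \<open>N\<close>,
  cut at the first visit to \<open>B\<close>. Since \<open>\<tau>\<close> is injective and its image
  avoids \<open>N\<close>, orbits can neither merge nor close up.\<close>

lemma linking_imp_disjoint_paths:
  assumes fin: "finite (pverts D)" and N: "N \<subseteq> pverts D" and "linking D N B \<tau>"
  shows "\<exists>Q. finite Q \<and> disjoint_paths D N B Q \<and> card Q = card N"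
proof -
  let ?V = "pverts D - B"
  have inj: "inj_on \<tau> ?V" and im: "\<And>u. u \<in> ?V \<Longrightarrow> \<tau> u \<in> pverts D - N"
    and arc: "\<And>u. u \<in> ?V \<Longrightarrow> \<tau> u = u \<or> (u, \<tau> u) \<in> parcs D"
    using assms(3) by (auto simp: linking_def)
  define s where "s n m = (\<tau> ^^ m) n" for n m
  have s_simps [simp]: "s n 0 = n" "s n (Suc m) = \<tau> (s n m)" for n m by (simp_all add: s_def)
  \<comment> \<open>Cancel \<open>\<tau>\<close> on both sides until one index is 0: then a node of
    \<open>N\<close> would be an image under \<open>\<tau>\<close> unless the other index is 0 as
    well. This gives both disjointness of two orbits and distinctness within one.\<close>
  have s_inj: "a = b \<and> n = n'"
    if "n \<in> N" "n' \<in> N" "\<forall>m<a. s n m \<in> ?V" "\<forall>m<b. s n' m \<in> ?V" "s n a = s n' b" for n n' a b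
    using that
  proof (induction a arbitrary: b)
    case 0
    then show ?case using im by (cases b) auto
  next
    case (Suc a)
    show ?case
    proof (cases b)
      case 0
      then show ?thesis using Suc.prems im[of "s n a"] by auto
    next
      case (Suc b')
      then have "s n a = s n' b'" using Suc.prems inj by (auto dest: inj_onD)
      then show ?thesis using Suc.IH[of b'] Suc.prems Suc by auto
    qed
  qed
  \<comment> \<open>An orbit missing \<open>B\<close> would be an infinite injective sequence of
    vertices.\<close>
  have "\<exists>k. s n k \<in> B" if n: "n \<in> N" for n
  proof (rule ccontr)
    assume *: "\<nexists>k. s n k \<in> B"
    have V: "s n m \<in> ?V" for m
    proof (induction m)
      case 0
      then show ?case using n N * by (metis DiffI s_simps(1) subsetD)
    next
      case (Suc m)
      then have "s n (Suc m) \<in> pverts D" using im by simp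
      then show ?case using * by blast
    qed
    then have "inj (s n)" using s_inj[OF n n] by (intro injI) auto
    moreover have "range (s n) \<subseteq> pverts D" using V by auto
    ultimately show False using fin by (meson finite_imageD finite_subset infinite_UNIV_nat)
  qed
  define K where "K n = (LEAST k. s n k \<in> B)" for n
  have K: "s n (K n) \<in> B" if "n \<in> N" for n
    unfolding K_def using \<open>n \<in> N \<Longrightarrow> \<exists>k. s n k \<in> B\<close>[OF that] by (rule LeastI_ex)
  have mem: "s n m \<in> pverts D \<and> (\<forall>l<m. s n l \<in> ?V)" if "n \<in> N" "m \<le> K n" for n m
    using that(2)
  proof (induction m)
    case 0
    then show ?case using that N by auto
  next
    case (Suc m)
    then have "s n m \<in> ?V" using not_less_Least[of m "\<lambda>k. s n k \<in> B"] by (auto simp: K_def)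
    then show ?case using Suc im by (auto simp: less_Suc_eq)
  qed
  define arcs where "arcs n = map (\<lambda>m. (s n m, s n (Suc m))) [0..<K n]" for n
  have verts: "pawalk_verts n (arcs n) = map (s n) [0..<Suc (K n)]" for n
    using pawalk_verts_map_upt[of 0 "K n" "s n"] by (simp add: arcs_def del: s_simps(2))
  have eq: "a = b \<and> n = n'"
    if "n \<in> N" "n' \<in> N" "a \<le> K n" "b \<le> K n'" "s n a = s n' b" for n n' a b
    using s_inj[of n n' a b] mem[of n a] mem[of n' b] that by auto
  have "pre_digraph.apath (with_proj D) n (arcs n) (s n (K n))" if n: "n \<in> N" for n
  proof -
    have "(s n m, \<tau> (s n m)) \<in> parcs D" if m: "m < K n" for m
    proof -
      have "s n m \<in> ?V" using mem[OF n, of "K n"] m by blast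
      \<comment> \<open>A fixed point of \<open>\<tau>\<close> on the way would repeat a vertex, so
        every step follows an arc.\<close>
      moreover have "\<tau> (s n m) \<noteq> s n m"
        using eq[OF n n, of "Suc m" m] m by auto
      ultimately show ?thesis using arc by blast
    qed
    then have "set (arcs n) \<subseteq> parcs D" by (auto simp: arcs_def)
    moreover have "pcas n (arcs n) (s n (K n))"
      using pcas_map_upt[of 0 "K n" "s n"] by (simp add: arcs_def del: s_simps(2))
    moreover have "distinct (pawalk_verts n (arcs n))"
      unfolding verts distinct_map using eq[OF n n]
      by (auto intro!: inj_onI simp: less_Suc_eq_le simp del: upt_Suc)
    ultimately show ?thesis
      using n N by (auto simp: pre_digraph.apath_def pre_digraph.awalk_def cas_with_proj_eq
          awalk_verts_with_proj_eq)
  qed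
  moreover have "disjnt (set (pawalk_verts n (arcs n))) (set (pawalk_verts n' (arcs n')))"
    if "n \<in> N" "n' \<in> N" "n \<noteq> n'" for n n'
    unfolding verts using eq[OF that(1,2)] that(3)
    by (auto simp: disjnt_iff less_Suc_eq_le simp del: upt_Suc)
  ultimately have "disjoint_paths D N B ((\<lambda>n. (n, arcs n)) ` N)"
    using K unfolding disjoint_paths_def pairwise_def by auto blast
  moreover have "card ((\<lambda>n. (n, arcs n)) ` N) = card N" by (auto intro!: card_image inj_onI)
  ultimately show ?thesis using finite_subset[OF N fin] by blast
qed

section \<open>From disjoint paths to a linking\<close>

lemma hd_pawalk_verts: "pcas u p v \<Longrightarrow> pawalk_verts u p ! 0 = u"
  by (cases p) auto

lemma last_pawalk_verts: "pcas u p v \<Longrightarrow> last (pawalk_verts u p) = v"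
proof (induction p arbitrary: u)
  case (Cons e p)
  then show ?case by (cases p) auto
qed simp

lemma nth_pawalk_verts_arc:
  "pcas u p v \<Longrightarrow> Suc k < length (pawalk_verts u p) \<Longrightarrow>
     (pawalk_verts u p ! k, pawalk_verts u p ! Suc k) \<in> set p"
proof (induction p arbitrary: u k)
  case (Cons e p)
  then show ?case
    by (cases k) (auto simp: hd_pawalk_verts)
qed simp

text \<open>The rank \<open>h\<close> counts the remaining steps on the path through a node.\<close>

lemma disjoint_paths_imp_linking:
  assumes wf: "pair_wf_digraph D" and N: "finite N" "N \<subseteq> pverts D"
    and paths: "disjoint_paths D N B Q" and card: "card Q = card N"
  shows "\<exists>\<tau> (h :: nat \<Rightarrow> nat). linking D N B \<tau> \<and> (\<forall>u \<in> pverts D - B. \<tau> u \<noteq> u \<longrightarrow> h (\<tau> u) < h u)"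
proof -
  define vs where "vs q = pawalk_verts (fst q) (snd q)" for q :: "nat \<times> (nat \<times> nat) awalk"
  have Q: "fst q \<in> N" "last (vs q) \<in> B" "set (snd q) \<subseteq> parcs D" "distinct (vs q)" "vs q ! 0 = fst q"
      "vs q \<noteq> []" "fst q \<in> pverts D"
      and Q_arc: "\<And>k. Suc k < length (vs q) \<Longrightarrow> (vs q ! k, vs q ! Suc k) \<in> parcs D"
    if "q \<in> Q" for q
  proof -
    have "case q of (u, p) \<Rightarrow> u \<in> N \<and> (\<exists>v \<in> B. pre_digraph.apath (with_proj D) u p v)"
      using paths that unfolding disjoint_paths_def by blast
    then obtain v where v: "v \<in> B" "pcas (fst q) (snd q) v" "set (snd q) \<subseteq> parcs D"
      "distinct (vs q)" "fst q \<in> N" "fst q \<in> pverts D"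
      by (auto simp: vs_def case_prod_unfold pre_digraph.apath_def pre_digraph.awalk_def
          cas_with_proj_eq awalk_verts_with_proj_eq)
    then show "fst q \<in> N" "last (vs q) \<in> B" "set (snd q) \<subseteq> parcs D" "distinct (vs q)"
      "vs q ! 0 = fst q" "fst q \<in> pverts D"
      by (auto simp: vs_def last_pawalk_verts hd_pawalk_verts)
    show "vs q \<noteq> []" by (cases "snd q") (auto simp: vs_def)
    show "(vs q ! k, vs q ! Suc k) \<in> parcs D" if "Suc k < length (vs q)" for k
      using nth_pawalk_verts_arc[OF v(2), of k] v(3) that by (auto simp: vs_def)
  qed
  have disj: "q = q'" if "q \<in> Q" "q' \<in> Q" "v \<in> set (vs q)" "v \<in> set (vs q')" for q q' v
  proof (rule ccontr)
    assume "q \<noteq> q'"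
    then have "disjnt (set (vs q)) (set (vs q'))"
      using paths that(1,2) by (auto simp: disjoint_paths_def pairwise_def vs_def case_prod_unfold)
    then show False using that(3,4) by (auto simp: disjnt_def)
  qed
  define U where "U = (\<Union>q\<in>Q. set (vs q))"
  have "\<forall>u\<in>U. \<exists>q k. q \<in> Q \<and> k < length (vs q) \<and> vs q ! k = u"
    by (metis U_def UN_E in_set_conv_nth)
  \<comment> \<open>\<open>qf u\<close> is the path through \<open>u\<close> and \<open>kf u\<close>
    the position of \<open>u\<close> on it; disjointness of the paths and distinctness of their
    vertices make both unique.\<close>
  then obtain qf kf where
    qk: "\<And>u. u \<in> U \<Longrightarrow> qf u \<in> Q \<and> kf u < length (vs (qf u)) \<and> vs (qf u) ! kf u = u"
    by metis
  have uniq: "qf (vs q ! k) = q \<and> kf (vs q ! k) = k" if "q \<in> Q" "k < length (vs q)" for q k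
  proof -
    have "vs q ! k \<in> set (vs q)" using that by simp
    then have "vs q ! k \<in> U" using that unfolding U_def by blast
    from qk[OF this] have *: "qf (vs q ! k) = q"
      using that disj[of "qf (vs q ! k)" q "vs q ! k"] by (metis nth_mem)
    then show ?thesis
      using qk[OF \<open>vs q ! k \<in> U\<close>] Q(4)[OF that(1)] that by (auto simp: nth_eq_iff_index_eq)
  qed
  have UB: "Suc (kf u) < length (vs (qf u))" if "u \<in> U" "u \<notin> B" for u
  proof -
    have "kf u \<noteq> length (vs (qf u)) - 1"
      using qk[OF that(1)] Q[of "qf u"] that(2) by (metis last_conv_nth)
    then show ?thesis using qk[OF that(1)] by linarith
  qed
  have "inj_on fst Q"
  proof (rule inj_onI)
    fix q q' assume "q \<in> Q" "q' \<in> Q" "fst q = fst q'"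
    then show "q = q'"
      using disj[of q q' "fst q"] Q[of q] Q[of q'] by (metis nth_mem length_greater_0_conv)
  qed
  then have "card (fst ` Q) = card N" using card by (simp add: card_image)
  \<comment> \<open>There are as many starting nodes as elements of \<open>N\<close>, so every node
    of \<open>N\<close> starts a path.\<close>
  then have fstQ: "fst ` Q = N" using Q(1) N(1) by (intro card_subset_eq) auto
  have N_start: "u \<in> U \<and> kf u = 0" if u: "u \<in> N" for u
  proof -
    obtain q where "q \<in> Q" "fst q = u" using u fstQ by blast
    then show ?thesis
      using Q[of q] uniq[of q 0] by (metis U_def UN_I length_greater_0_conv nth_mem)
  qed
  \<comment> \<open>The successor along the paths, and the identity off them. At the end of a path
    the index is out of range, but that node lies in \<open>B\<close>, where a linking demands
    nothing.\<close>
  define \<tau> where "\<tau> u = (if u \<in> U then vs (qf u) ! Suc (kf u) else u)" for u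
  define h where "h u = length (vs (qf u)) - kf u" for u
  have step: "\<tau> u \<in> U \<and> qf (\<tau> u) = qf u \<and> kf (\<tau> u) = Suc (kf u) \<and> (u, \<tau> u) \<in> parcs D"
    if "u \<in> U" "u \<notin> B" for u
  proof -
    have "vs (qf u) ! Suc (kf u) \<in> U"
      unfolding U_def using UB[OF that] qk[OF that(1)] by (metis UN_I nth_mem)
    then show ?thesis
      using UB[OF that] qk[OF that(1)] Q_arc[of "qf u" "kf u"] uniq[of "qf u" "Suc (kf u)"] that
      by (simp add: \<tau>_def)
  qed
  show ?thesis
  proof (intro exI conjI ballI impI)
    show "linking D N B \<tau>"
      unfolding linking_def
    proof (intro conjI ballI subsetI inj_onI)
      fix u v assume uv: "u \<in> pverts D - B" "v \<in> pverts D - B" "\<tau> u = \<tau> v"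
      show "u = v"
      proof (cases "u \<in> U \<and> v \<in> U")
        case True
        then have "qf u = qf v" "kf u = kf v" using step[of u] step[of v] uv by auto
        then show ?thesis using qk True by metis
      next
        \<comment> \<open>A path node outside \<open>B\<close> is sent to a path node and a node off
          the paths is fixed, so equal images force both nodes off the paths.\<close>
        case False
        then show ?thesis using step[of u] step[of v] uv by (auto simp: \<tau>_def split: if_splits)
      qed
    next
      fix w assume "w \<in> \<tau> ` (pverts D - B)"
      then obtain u where u: "u \<in> pverts D" "u \<notin> B" "w = \<tau> u" by auto
      show "w \<in> pverts D - N"
      proof (cases "u \<in> U")
        case True
        \<comment> \<open>Nodes of \<open>N\<close> have position 0 on their paths, whereas the
          image of a path node has a positive position.\<close>
        then have "(u, w) \<in> parcs D" "kf w \<noteq> 0" using step[of u] u by auto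
        then show ?thesis
          using N_start pair_wf_digraph.in_arcsD2[OF wf] by auto
      next
        case False
        then show ?thesis using u N_start by (auto simp: \<tau>_def)
      qed
    next
      fix u assume "u \<in> pverts D - B"
      then show "\<tau> u = u \<or> (u, \<tau> u) \<in> parcs D" using step[of u] by (auto simp: \<tau>_def)
    qed
  next
    fix u assume "u \<in> pverts D - B" "\<tau> u \<noteq> u"
    then have "u \<in> U" "u \<notin> B" by (auto simp: \<tau>_def split: if_splits)
    then show "h (\<tau> u) < h u"
      using step[of u] UB[of u] by (simp add: h_def)
  qed
qed

text \<open>Vertex-disjoint paths have distinct first nodes, and these lie in
  \<open>A\<close>.\<close>

lemma card_disjoint_paths_le:
  assumes "finite A" "disjoint_paths D A B Q"
  shows "card Q \<le> card A"
proof (rule card_inj_on_le[of fst])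
  show "inj_on fst Q"
  proof (rule inj_onI, rule ccontr)
    fix q q' assume q: "q \<in> Q" "q' \<in> Q" "fst q = fst q'" "q \<noteq> q'"
    have start: "fst q \<in> set (pawalk_verts (fst q) (snd q))" if "q \<in> Q" for q
    proof -
      have "fst (hd (snd q)) = fst q" if "snd q \<noteq> []"
        using assms(2) \<open>q \<in> Q\<close> that
        by (cases "snd q") (fastforce simp: disjoint_paths_def pre_digraph.apath_def
            pre_digraph.awalk_def cas_with_proj_eq)+
      then show ?thesis by (cases "snd q") auto
    qed
    have "disjnt (set (pawalk_verts (fst q) (snd q))) (set (pawalk_verts (fst q') (snd q')))"
      using assms(2) q by (auto simp: disjoint_paths_def pairwise_def case_prod_unfold)
    then show False using start[OF q(1)] start[OF q(2)] q(3) by (auto simp: disjnt_def)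
  qed
  show "fst ` Q \<subseteq> A" using assms(2) by (auto simp: disjoint_paths_def)
qed fact

text \<open>The bound \<open>card A\<close> and the empty family make the set under
  \<open>Max\<close> finite and nonempty, so the maximum is attained.\<close>

lemma max_disjoint_paths_eq_card_iff:
  assumes "finite A"
  shows "max_disjoint_paths D A B = card A \<longleftrightarrow>
    (\<exists>Q. finite Q \<and> disjoint_paths D A B Q \<and> card Q = card A)"
proof -
  let ?S = "{card Q |Q. finite Q \<and> disjoint_paths D A B Q}"
  have le: "\<forall>k\<in>?S. k \<le> card A" using card_disjoint_paths_le[OF assms] by blast
  then have "finite ?S" by (meson bounded_nat_set_is_finite le_imp_less_Suc)
  moreover have "disjoint_paths D A B {}" by (simp add: disjoint_paths_def)
  then have "?S \<noteq> {}" by auto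
  ultimately have "Max ?S = card A \<longleftrightarrow> card A \<in> ?S" using le by (subst Max_eq_iff) auto
  then show ?thesis unfolding max_disjoint_paths_def by auto
qed

section \<open>Sufficiency\<close>

lemma mult_mat_vec_nth:
  assumes "A \<in> carrier_mat n m" "x \<in> carrier_vec m" "i < n"
  shows "(A *\<^sub>v x) $ i = (\<Sum>j<m. A $$ (i, j) * x $ j)"
  using assms by (auto simp: scalar_prod_def lessThan_atLeast0 intro!: sum.cong)

text \<open>Each row of \<open>C\<close> reads off one entry of \<open>x\<close>, so the matrix
  equation is a condition on the support of \<open>x\<close>.\<close>

lemma selection_mult_vec_eq_0_iff:
  assumes C: "selection_matrix p L C" and x: "x \<in> carrier_vec L"
  shows "C *\<^sub>v x = 0\<^sub>v p \<longleftrightarrow> (\<forall>c \<in> measured_nodes C. x $ c = 0)"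
proof -
  have carr: "C \<in> carrier_mat p L" using C by (simp add: selection_matrix_def)
  obtain f where f: "\<And>r. r < p \<Longrightarrow> f r < L \<and> row C r = unit_vec L (f r)"
    using C unfolding selection_matrix_def by metis
  have entry: "C $$ (r, c) = (if c = f r then 1 else 0)" if "r < p" "c < L" for r c
  proof -
    have "C $$ (r, c) = row C r $ c" using that carr by simp
    then show ?thesis using f[OF that(1)] that(2) by (simp add: unit_vec_def)
  qed
  have meas: "measured_nodes C = f ` {..<p}"
    using carr f by (auto simp: measured_nodes_def entry image_iff split: if_splits)
  have "(C *\<^sub>v x) $ r = x $ f r" if "r < p" for r
    using f[OF that] carr x that by (simp add: scalar_prod_left_unit)
  then have "C *\<^sub>v x = 0\<^sub>v p \<longleftrightarrow> (\<forall>r<p. x $ f r = 0)"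
    using carr by (auto simp: vec_eq_iff)
  then show ?thesis unfolding meas by auto
qed

section \<open>Generic invertibility and generically trivial kernels\<close>

lemma rational_in_params_one_minus_param_matrix:
  assumes "i < L" "j < L"
  shows "rational_in_params (\<lambda>P. (1\<^sub>m L - param_matrix L D d n P) $$ (i, j))"
proof -
  have "(1\<^sub>m L - param_matrix L D d n P) $$ (i, j) =
      1\<^sub>m L $$ (i, j) + (- 1) * param_matrix L D d n P $$ (i, j)" for P
    using assms param_matrix_carrier[of L D d n P] by auto
  then show ?thesis
    by (simp only:) (intro rational_in_params_add rational_in_params_mult
        rational_in_params_const rational_in_params_param_matrix assms)
qed

lemma AE_det_one_minus_param_matrix:
  assumes "finite (parcs D)"
  shows "AE P in (\<Pi>\<^sub>M x \<in> param_set D n. lborel). det (1\<^sub>m L - param_matrix L D d n P) \<noteq> 0"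
proof (rule AE_rational_in_params_nonzero)
  \<comment> \<open>With all gains 0 the matrix \<open>I - G\<close> is the identity;
    \<open>restrict\<close> makes this a point of the product space.\<close>
  let ?P = "restrict (\<lambda>_. 0) (param_set D n)"
  have "param_matrix L D d n ?P = 0\<^sub>m L L"
    by (rule eq_matI) (auto simp: param_matrix_def param_entry_def param_set_def fract_collapse)
  then have "1\<^sub>m L - param_matrix L D d n ?P = 1\<^sub>m L" by (intro eq_matI) auto
  then show "det (1\<^sub>m L - param_matrix L D d n ?P) \<noteq> 0" by simp
  show "rational_in_params (\<lambda>P. det (1\<^sub>m L - param_matrix L D d n P))"
    by (rule rational_in_params_det[of _ L])
      (auto intro: rational_in_params_one_minus_param_matrix minus_carrier_mat param_matrix_carrier)
qed (auto intro: finite_param_set assms)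

text \<open>Apart from the gain, numerator and denominator are monic, so an entry is switched on and
  off by \<open>Kappa\<close> alone, for all degrees and delays.\<close>

lemma param_entry_eq_0_iff: "param_entry d n P i j = 0 \<longleftrightarrow> P (Kappa i j) = 0"
  by (simp add: param_entry_def Zero_fract_def eq_fract monic_poly_nonzero)

text \<open>The parameters with \<open>\<kappa> = 1\<close> on the arcs \<open>(u, \<tau> u)\<close> and \<open>\<kappa> = 0\<close> elsewhere witness that the
  determinant of the rows \<open>\<tau> u\<close> and the columns \<open>u\<close> outside \<open>B\<close> does not vanish identically.\<close>

lemma AE_trivial_kernel_if_linking:
  fixes h :: "nat \<Rightarrow> nat"
  assumes D: "finite (parcs D)" "pverts D = {..<L}"
    and link: "linking D N B \<tau>"
    and h: "\<forall>u \<in> pverts D - B. \<tau> u \<noteq> u \<longrightarrow> h (\<tau> u) < h u"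
  shows "AE P in (\<Pi>\<^sub>M x \<in> param_set D n. lborel). \<forall>x \<in> carrier_vec L.
    (\<forall>c \<in> B. c < L \<longrightarrow> x $ c = 0) \<longrightarrow>
    (\<forall>v<L. v \<notin> N \<longrightarrow> ((1\<^sub>m L - param_matrix L D d n P) *\<^sub>v x) $ v = 0) \<longrightarrow> x = 0\<^sub>v L"
proof -
  let ?G = "param_matrix L D d n"
  \<comment> \<open>Unit rows at the nodes of \<open>B\<close> make the system square: its kernel
    consists of the \<open>x\<close> that vanish on \<open>B\<close> and are annihilated by all rows
    \<open>\<tau> u\<close> of \<open>I - G\<close>.\<close>
  define M where "M P = mat L L (\<lambda>(u, j). if u \<in> B then 1\<^sub>m L $$ (u, j)
    else (1\<^sub>m L - ?G P) $$ (\<tau> u, j))" for P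
  have M: "M P \<in> carrier_mat L L" for P by (simp add: M_def)
  have A: "1\<^sub>m L - ?G P \<in> carrier_mat L L" for P
    by (intro minus_carrier_mat param_matrix_carrier)
  have inj: "inj_on \<tau> ({..<L} - B)" and \<tau>: "\<And>u. u < L \<Longrightarrow> u \<notin> B \<Longrightarrow> \<tau> u < L \<and> \<tau> u \<notin> N"
    and arc: "\<And>u. u < L \<Longrightarrow> u \<notin> B \<Longrightarrow> \<tau> u \<noteq> u \<Longrightarrow> (u, \<tau> u) \<in> parcs D"
    using link unfolding linking_def D(2) by auto
  have Mx: "(M P *\<^sub>v x) $ u = (if u \<in> B then x $ u else ((1\<^sub>m L - ?G P) *\<^sub>v x) $ (\<tau> u))"
    if u: "u < L" and x: "x \<in> carrier_vec L" for P x u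
  proof (cases "u \<in> B")
    case True
    have "(M P *\<^sub>v x) $ u = (\<Sum>j<L. (if u = j then x $ j else 0))"
      unfolding mult_mat_vec_nth[OF M x u] by (rule sum.cong) (auto simp: M_def u True)
    then show ?thesis using True u by simp
  next
    case False
    then have \<tau>u: "\<tau> u < L" using \<tau> u by blast
    show ?thesis
      unfolding mult_mat_vec_nth[OF M x u] mult_mat_vec_nth[OF A x \<tau>u]
      using False by (auto simp: M_def u intro!: sum.cong)
  qed
  \<comment> \<open>Where \<open>\<tau> j = j\<close>, the identity in \<open>I - G\<close> already
    supplies the nonzero entry, so only true arcs receive gain 1.\<close>
  define P0 where "P0 = restrict (\<lambda>q. case q of
    Kappa i j \<Rightarrow> if j \<notin> B \<and> \<tau> j = i \<and> i \<noteq> j then 1 else 0 | _ \<Rightarrow> (0::real)) (param_set D n)"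
  have G0: "?G P0 $$ (i, j) \<noteq> 0 \<longleftrightarrow> j \<notin> B \<and> \<tau> j = i \<and> i \<noteq> j" if "i < L" "j < L" for i j
  proof (cases "(j, i) \<in> parcs D")
    case True
    then have "P0 (Kappa i j) = (if j \<notin> B \<and> \<tau> j = i \<and> i \<noteq> j then 1 else 0)"
      by (simp add: P0_def param_set_def)
    then show ?thesis
      using True that by (simp add: param_matrix_def param_entry_eq_0_iff)
  next
    case False
    then show ?thesis using arc that by (auto simp: param_matrix_def)
  qed
  have "det (M P0) \<noteq> 0"
  proof
    assume "det (M P0) = 0"
    then obtain x where x: "x \<in> carrier_vec L" "x \<noteq> 0\<^sub>v L" "M P0 *\<^sub>v x = 0\<^sub>v L"
      using det_0_iff_vec_prod_zero_field[OF M] by blast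
    \<comment> \<open>Since \<open>\<tau>\<close> is injective, row \<open>\<tau> u\<close> of
      \<open>I - G\<close> involves only the entries of \<open>x\<close> at \<open>\<tau> u\<close>
      and at \<open>u\<close>. The rank drops from \<open>u\<close> to \<open>\<tau> u\<close>, so
      the former is 0 by induction, and hence so is the latter.\<close>
    have "x $ u = 0" if "u < L" for u
      using that
    proof (induction "h u" arbitrary: u rule: less_induct)
      case less
      have 0: "(if u \<in> B then x $ u else ((1\<^sub>m L - ?G P0) *\<^sub>v x) $ (\<tau> u)) = 0"
        using Mx[OF less.prems x(1), of P0] x(3) less.prems by simp
      show ?case
      proof (cases "u \<in> B")
        case False
        then have \<tau>u: "\<tau> u < L" using \<tau> less.prems by blast
        have entry: "(1\<^sub>m L - ?G P0) $$ (\<tau> u, j) * x $ j =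
            (if j = \<tau> u then x $ j else 0) - (if j = u then ?G P0 $$ (\<tau> u, j) * x $ j else 0)"
          if "j < L" for j
        proof -
          have "j = u" if "?G P0 $$ (\<tau> u, j) \<noteq> 0"
            using that G0[OF \<tau>u \<open>j < L\<close>] inj_onD[OF inj, of j u] \<open>j < L\<close> less.prems False by auto
          then show ?thesis
            using \<open>j < L\<close> \<tau>u param_matrix_carrier[of L D d n P0] by (auto simp: algebra_simps)
        qed
        have "0 = (\<Sum>j<L. (1\<^sub>m L - ?G P0) $$ (\<tau> u, j) * x $ j)"
          using 0 False unfolding mult_mat_vec_nth[OF A x(1) \<tau>u] by simp
        also have "\<dots> = x $ \<tau> u - ?G P0 $$ (\<tau> u, u) * x $ u"
          using \<tau>u less.prems by (simp add: entry sum_subtractf)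
        finally have eq: "x $ \<tau> u = ?G P0 $$ (\<tau> u, u) * x $ u" by simp
        show ?thesis
        proof (cases "\<tau> u = u")
          case True
          then have "?G P0 $$ (\<tau> u, u) = 0" using G0[OF \<tau>u less.prems] by auto
          then show ?thesis using eq True by simp
        next
          case neq: False
          then have "?G P0 $$ (\<tau> u, u) \<noteq> 0" using G0[OF \<tau>u less.prems] False by auto
          moreover have "x $ \<tau> u = 0"
            using less.hyps[of "\<tau> u"] h neq less.prems False \<tau>u D(2) by auto
          ultimately show ?thesis using eq by simp
        qed
      qed (use 0 in simp)
    qed
    then have "x = 0\<^sub>v L" using x(1) by (intro eq_vecI) auto
    then show False using x(2) by simp
  qed
  moreover have "rational_in_params (\<lambda>P. det (M P))"
  proof (rule rational_in_params_det[OF M])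
    fix u j assume "u < L" "j < L"
    then show "rational_in_params (\<lambda>P. M P $$ (u, j))"
      using \<tau> by (cases "u \<in> B")
        (auto simp: M_def simp del: index_minus_mat
          intro: rational_in_params_const rational_in_params_one_minus_param_matrix)
  qed
  ultimately have "AE P in (\<Pi>\<^sub>M x \<in> param_set D n. lborel). det (M P) \<noteq> 0"
    by (intro AE_rational_in_params_nonzero[of _ _ P0])
      (auto simp: P0_def intro: finite_param_set D)
  then show ?thesis
  proof eventually_elim
    case (elim P)
    show ?case
    proof (intro ballI impI, rule ccontr)
      fix x assume x: "x \<in> carrier_vec L" "\<forall>c \<in> B. c < L \<longrightarrow> x $ c = 0"
        "\<forall>v<L. v \<notin> N \<longrightarrow> ((1\<^sub>m L - ?G P) *\<^sub>v x) $ v = 0" "x \<noteq> 0\<^sub>v L"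
      have "M P *\<^sub>v x = 0\<^sub>v L"
      proof (rule eq_vecI)
        fix u assume "u < dim_vec (0\<^sub>v L)"
        then have u: "u < L" by simp
        then show "(M P *\<^sub>v x) $ u = 0\<^sub>v L $ u"
          unfolding Mx[OF u x(1)] using x \<tau>[OF u] by auto
      qed (use M[of P] in auto)
      then show False
        using elim x det_0_iff_vec_prod_zero_field[OF M[of P]] by blast
    qed
  qed
qed

lemma consistent_param_matrix: "consistent D (param_matrix L D d n P)"
  by (auto simp: consistent_def param_matrix_def split: if_splits)

text \<open>Multiplying \<open>C T\<close> by \<open>I - G\<close> or by \<open>I - G'\<close> gives
  \<open>C\<close>, so \<open>C T (G' - G) = 0\<close> exactly and not just to first order. For a
  column \<open>\<delta>\<close> of \<open>G' - G\<close>, the vector \<open>T \<delta>\<close>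
  meets the assumptions of \<open>ker\<close>; it is 0, and so is \<open>\<delta>\<close>.\<close>

lemma eq_if_measured_closed_loop_eq:
  assumes C: "selection_matrix p L C"
    and G: "G \<in> carrier_mat L L" "det (1\<^sub>m L - G) \<noteq> 0" "consistent D G"
    and G': "G' \<in> carrier_mat L L" "det (1\<^sub>m L - G') \<noteq> 0" "consistent D G'"
    and eq: "C * closed_loop G = C * closed_loop G'"
    and ker: "\<And>i x. i < L \<Longrightarrow> x \<in> carrier_vec L \<Longrightarrow> \<forall>c \<in> measured_nodes C. x $ c = 0 \<Longrightarrow>
      \<forall>v<L. v \<notin> out_neighbors D i \<longrightarrow> ((1\<^sub>m L - G) *\<^sub>v x) $ v = 0 \<Longrightarrow> x = 0\<^sub>v L"
  shows "G = G'"
proof (rule eq_matI)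
  let ?A = "1\<^sub>m L - G" and ?A' = "1\<^sub>m L - G'" and ?T = "closed_loop G"
  note T = closed_loop_inverse[OF G(1,2)] and T' = closed_loop_inverse[OF G'(1,2)]
  have carr: "C \<in> carrier_mat p L" using C by (simp add: selection_matrix_def)
  have A: "?A \<in> carrier_mat L L" "?A' \<in> carrier_mat L L" using G G' by auto
  have "C * ?T * ?A = C"
    using assoc_mult_mat[OF carr T(1) A(1)] T(3) carr by simp
  moreover have "C * ?T * ?A' = C"
    using assoc_mult_mat[OF carr T'(1) A(2)] T'(3) carr eq by simp
  moreover have "G' - G = ?A - ?A'" using G G' by (intro eq_matI) auto
  ultimately have 0: "C * ?T * (G' - G) = 0\<^sub>m p L"
    using mult_minus_distrib_mat[of "C * ?T" p L ?A L ?A'] carr T A by auto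
  fix v i assume "v < dim_row G'" "i < dim_col G'"
  then have v: "v < L" and i: "i < L" using G' by auto
  let ?\<delta> = "col (G' - G) i"
  let ?x = "?T *\<^sub>v ?\<delta>"
  have \<delta>: "?\<delta> \<in> carrier_vec L" using G(1) by (intro carrier_vecI) simp
  then have x: "?x \<in> carrier_vec L" using T by auto
  have "?A *\<^sub>v ?x = ?\<delta>"
    using assoc_mult_mat_vec[OF A(1) T(1) \<delta>] T(2) \<delta> by simp
  moreover have "?x = 0\<^sub>v L"
  proof (rule ker[OF i x])
    have "C *\<^sub>v ?x = C * ?T *\<^sub>v ?\<delta>"
      using assoc_mult_mat_vec[OF carr T(1) \<delta>] by simp
    also have "\<dots> = col (C * ?T * (G' - G)) i"
      using G G' i by (intro eq_vecI) auto
    also have "\<dots> = 0\<^sub>v p" unfolding 0 using i by (intro eq_vecI) auto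
    finally show "\<forall>c \<in> measured_nodes C. ?x $ c = 0"
      using selection_mult_vec_eq_0_iff[OF C x] by simp
    show "\<forall>v<L. v \<notin> out_neighbors D i \<longrightarrow> (?A *\<^sub>v ?x) $ v = 0"
    proof (intro allI impI)
      fix v assume v: "v < L" "v \<notin> out_neighbors D i"
      then have "G $$ (v, i) = 0" "G' $$ (v, i) = 0"
        using G(1,3) G'(1,3) i unfolding consistent_def out_neighbors_def by auto
      then show "(?A *\<^sub>v ?x) $ v = 0"
        unfolding \<open>?A *\<^sub>v ?x = ?\<delta>\<close> using v(1) i G(1) G'(1) by simp
    qed
  qed
  moreover have "?A *\<^sub>v 0\<^sub>v L = 0\<^sub>v L" using G(1) by (intro eq_vecI) (auto simp: scalar_prod_def)
  ultimately have "?\<delta> = 0\<^sub>v L" by simp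
  then have "?\<delta> $ v = 0" using v by simp
  then show "G $$ (v, i) = G' $$ (v, i)" using G G' v i by auto
qed (use G G' in auto)

text \<open>The null sets of the finitely many nodes and that of singular \<open>I - G\<close> are
  discarded together. A competing matrix has an invertible \<open>I - G\<close> because it is
  well-posed.\<close>

lemma generically_identifiable_if_linkings:
  assumes D: "finite (parcs D)" "pverts D = {..<L}" and C: "selection_matrix p L C"
    and link: "\<And>i. i < L \<Longrightarrow> \<exists>\<tau> (h :: nat \<Rightarrow> nat).
      linking D (out_neighbors D i) (measured_nodes C) \<tau> \<and>
      (\<forall>u \<in> pverts D - measured_nodes C. \<tau> u \<noteq> u \<longrightarrow> h (\<tau> u) < h u)"
  shows "generically_identifiable L D C"
  unfolding generically_identifiable_def
proof (intro allI)
  fix d n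
  let ?M = "\<Pi>\<^sub>M x \<in> param_set D n. (lborel :: real measure)"
  have "AE P in ?M. \<forall>i\<in>{..<L}. \<forall>x \<in> carrier_vec L.
    (\<forall>c \<in> measured_nodes C. c < L \<longrightarrow> x $ c = 0) \<longrightarrow>
    (\<forall>v<L. v \<notin> out_neighbors D i \<longrightarrow> ((1\<^sub>m L - param_matrix L D d n P) *\<^sub>v x) $ v = 0) \<longrightarrow>
      x = 0\<^sub>v L"
  proof (rule eventually_ball_finite)
    show "\<forall>i\<in>{..<L}. AE P in ?M. \<forall>x \<in> carrier_vec L.
      (\<forall>c \<in> measured_nodes C. c < L \<longrightarrow> x $ c = 0) \<longrightarrow>
      (\<forall>v<L. v \<notin> out_neighbors D i \<longrightarrow> ((1\<^sub>m L - param_matrix L D d n P) *\<^sub>v x) $ v = 0) \<longrightarrow>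
        x = 0\<^sub>v L"
      using link AE_trivial_kernel_if_linking[OF D] by (meson lessThan_iff)
  qed simp
  moreover have "AE P in ?M. det (1\<^sub>m L - param_matrix L D d n P) \<noteq> 0"
    by (rule AE_det_one_minus_param_matrix[OF D(1)])
  ultimately show "AE P in ?M. \<forall>G. network_matrix L G \<and> consistent D G \<longrightarrow>
      C * closed_loop (param_matrix L D d n P) = C * closed_loop G \<longrightarrow> param_matrix L D d n P = G"
  proof eventually_elim
    case (elim P)
    show ?case
    proof (intro allI impI)
      fix G assume G: "network_matrix L G \<and> consistent D G"
        and eq: "C * closed_loop (param_matrix L D d n P) = C * closed_loop G"
      have carr: "G \<in> carrier_mat L L" using G by (simp add: network_matrix_def)
      have "invertible_mat (1\<^sub>m L - G)"
        using G carr by (auto simp: network_matrix_def well_posed_def)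
      then have "det (1\<^sub>m L - G) \<noteq> 0" using carr by (subst (asm) invertible_mat_iff_det[of _ L]) auto
      then show "param_matrix L D d n P = G"
        using eq_if_measured_closed_loop_eq[OF C param_matrix_carrier elim(2) consistent_param_matrix
            carr _ _ eq] G elim(1) by blast
    qed
  qed
qed

section \<open>Proper and stable rational functions\<close>

lemma map_poly_of_real_mult:
  "map_poly complex_of_real (p * q) = map_poly complex_of_real p * map_poly complex_of_real q"
  by (rule poly_eqI) (simp add: coeff_map_poly coeff_mult)

text \<open>One fraction, not necessarily in lowest terms, witnesses both properties, so closure
  under sums and products needs only a common denominator.\<close>

definition proper_stable :: "ratfun \<Rightarrow> bool" where
  "proper_stable f \<longleftrightarrow> (\<exists>a b. b \<noteq> 0 \<and> f = Fract a b \<and> degree a \<le> degree b \<and>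
     (\<forall>z :: complex. poly (map_poly complex_of_real b) z = 0 \<longrightarrow> cmod z < 1))"

lemma proper_stable_imp_proper: "proper_stable f \<Longrightarrow> proper f"
  by (auto simp: proper_stable_def proper_def)

text \<open>Cancelling the gcd can only remove roots of the denominator.\<close>

lemma proper_stable_imp_stable:
  assumes "proper_stable f"
  shows "stable f"
proof -
  obtain a b where b: "b \<noteq> 0" "f = Fract a b"
      "\<And>z :: complex. poly (map_poly complex_of_real b) z = 0 \<Longrightarrow> cmod z < 1"
    using assms by (auto simp: proper_stable_def)
  obtain a' b' where red: "a = a' * gcd a b" "b = b' * gcd a b" "coprime a' b'"
    using gcd_coprime_exists[of a b] b by auto
  have "f = Fract a' b'"
    using b red by (metis eq_fract(1) mult.assoc mult.commute mult_eq_0_iff)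
  moreover have "cmod z < 1" if "poly (map_poly complex_of_real b') z = 0" for z
  proof (rule b(3))
    show "poly (map_poly complex_of_real b) z = 0"
      by (subst red(2)) (simp add: that map_poly_of_real_mult)
  qed
  ultimately show ?thesis
    unfolding stable_def using red b by (intro exI[of _ a'] exI[of _ b']) auto
qed

lemma proper_stable_const: "proper_stable (Fract [:c:] 1)"
  unfolding proper_stable_def by (intro exI[of _ "[:c:]"] exI[of _ 1]) auto

lemma proper_stable_0: "proper_stable 0"
  using proper_stable_const[of 0] by (simp add: Zero_fract_def)

lemma proper_stable_1: "proper_stable 1"
  using proper_stable_const[of 1] by (simp add: One_fract_def one_pCons)

lemma proper_add:
  assumes "proper f" "proper g"
  shows "proper (f + g)"
proof -
  obtain a b c d where "b \<noteq> 0" "f = Fract a b" "degree a \<le> degree b"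
      "d \<noteq> 0" "g = Fract c d" "degree c \<le> degree d"
    using assms by (auto simp: proper_def)
  then show ?thesis
    unfolding proper_def
    by (intro exI[of _ "a * d + c * b"] exI[of _ "b * d"])
      (auto simp: degree_mult_eq intro!: degree_add_le order.trans[OF degree_mult_le])
qed

lemma proper_mult:
  assumes "proper f" "proper g"
  shows "proper (f * g)"
proof -
  obtain a b c d where "b \<noteq> 0" "f = Fract a b" "degree a \<le> degree b"
      "d \<noteq> 0" "g = Fract c d" "degree c \<le> degree d"
    using assms by (auto simp: proper_def)
  then show ?thesis
    unfolding proper_def
    by (intro exI[of _ "a * c"] exI[of _ "b * d"])
      (auto simp: degree_mult_eq intro!: order.trans[OF degree_mult_le])
qed

lemma proper_minus: "proper f \<Longrightarrow> proper (- f)"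
  unfolding proper_def by (metis degree_minus minus_fract)

lemma proper_diff: "proper f \<Longrightarrow> proper g \<Longrightarrow> proper (f - g)"
  using proper_add[of f "- g"] proper_minus by simp

lemma proper_stable_add:
  assumes "proper_stable f" "proper_stable g"
  shows "proper_stable (f + g)"
proof -
  obtain a b c d where "b \<noteq> 0" "f = Fract a b" "degree a \<le> degree b"
      "d \<noteq> 0" "g = Fract c d" "degree c \<le> degree d"
      "\<And>z :: complex. poly (map_poly complex_of_real b) z = 0 \<Longrightarrow> cmod z < 1"
      "\<And>z :: complex. poly (map_poly complex_of_real d) z = 0 \<Longrightarrow> cmod z < 1"
    using assms unfolding proper_stable_def by metis
  then show ?thesis
    unfolding proper_stable_def
    by (intro exI[of _ "a * d + c * b"] exI[of _ "b * d"])
      (auto simp: degree_mult_eq map_poly_of_real_mult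
        intro!: degree_add_le order.trans[OF degree_mult_le])
qed

lemma proper_stable_mult:
  assumes "proper_stable f" "proper_stable g"
  shows "proper_stable (f * g)"
proof -
  obtain a b c d where "b \<noteq> 0" "f = Fract a b" "degree a \<le> degree b"
      "d \<noteq> 0" "g = Fract c d" "degree c \<le> degree d"
      "\<And>z :: complex. poly (map_poly complex_of_real b) z = 0 \<Longrightarrow> cmod z < 1"
      "\<And>z :: complex. poly (map_poly complex_of_real d) z = 0 \<Longrightarrow> cmod z < 1"
    using assms unfolding proper_stable_def by metis
  then show ?thesis
    unfolding proper_stable_def
    by (intro exI[of _ "a * c"] exI[of _ "b * d"])
      (auto simp: degree_mult_eq map_poly_of_real_mult
        intro!: order.trans[OF degree_mult_le])
qed

lemma proper_sum: "(\<And>i. i \<in> S \<Longrightarrow> proper (f i)) \<Longrightarrow> proper (sum f S)"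
  by (induction S rule: infinite_finite_induct)
    (auto intro: proper_add proper_stable_imp_proper[OF proper_stable_0])

lemma proper_stable_sum: "(\<And>i. i \<in> S \<Longrightarrow> proper_stable (f i)) \<Longrightarrow> proper_stable (sum f S)"
  by (induction S rule: infinite_finite_induct) (auto intro: proper_stable_add proper_stable_0)

lemma proper_stable_prod: "(\<And>i. i \<in> S \<Longrightarrow> proper_stable (f i)) \<Longrightarrow> proper_stable (prod f S)"
  by (induction S rule: infinite_finite_induct) (auto intro: proper_stable_mult proper_stable_1)

lemma proper_stable_minus: "proper_stable f \<Longrightarrow> proper_stable (- f)"
proof -
  have "Fract [:- 1:] 1 = (- 1 :: ratfun)" by (simp add: One_fract_def one_pCons)
  then show "proper_stable f \<Longrightarrow> proper_stable (- f)"
    using proper_stable_mult[OF proper_stable_const[of "-1"], of f] by simp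
qed

lemma proper_stable_diff: "proper_stable f \<Longrightarrow> proper_stable g \<Longrightarrow> proper_stable (f - g)"
  using proper_stable_add[of f "- g"] proper_stable_minus by simp

section \<open>Properness and stability of matrices and closed loops\<close>

lemma proper_stable_det:
  assumes A: "A \<in> carrier_mat n n"
    and "\<And>i j. i < n \<Longrightarrow> j < n \<Longrightarrow> proper_stable (A $$ (i, j))"
  shows "proper_stable (det A)"
proof -
  have "p i < n" if "p permutes {0..<n}" "i < n" for p i
    using permutes_in_image[OF that(1), of i] that(2) by simp
  moreover have "proper_stable (signof p)" for p :: "nat \<Rightarrow> nat"
    by (cases p rule: sign_cases) (auto intro: proper_stable_1 proper_stable_minus)
  ultimately show ?thesis
    unfolding det_def'[OF A]
    by (auto intro!: proper_stable_sum proper_stable_mult proper_stable_prod assms)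
qed

lemma proper_stable_mult_mat:
  assumes A: "A \<in> carrier_mat n m" "\<And>i j. i < n \<Longrightarrow> j < m \<Longrightarrow> proper_stable (A $$ (i, j))"
    and B: "B \<in> carrier_mat m k" "\<And>i j. i < m \<Longrightarrow> j < k \<Longrightarrow> proper_stable (B $$ (i, j))"
    and "i < n" "j < k"
  shows "proper_stable ((A * B) $$ (i, j))"
  using assms by (auto simp: scalar_prod_def intro!: proper_stable_sum proper_stable_mult)

text \<open>All absolute row sums of \<open>K\<close> are below 1. The eigenvalue equation, read at
  an index where the eigenvector has maximal modulus, bounds the eigenvalue by such a row
  sum.\<close>

lemma char_poly_roots_small:
  fixes K :: "real mat"
  assumes K: "K \<in> carrier_mat L L"
    and small: "\<And>i j. i < L \<Longrightarrow> j < L \<Longrightarrow> real L * \<bar>K $$ (i, j)\<bar> < 1"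
    and root: "poly (map_poly complex_of_real (char_poly K)) z = 0"
  shows "cmod z < 1"
proof -
  let ?K = "map_mat complex_of_real K"
  have K': "?K \<in> carrier_mat L L" using K by simp
  have "poly (char_poly ?K) z = 0"
    using root unfolding of_real_hom.char_poly_hom[OF K] .
  then obtain v where v: "v \<in> carrier_vec L" "v \<noteq> 0\<^sub>v L" "?K *\<^sub>v v = z \<cdot>\<^sub>v v"
    using eigenvalue_root_char_poly[OF K'] K by (auto simp: eigenvalue_def eigenvector_def)
  obtain k where k: "k < L" "v $ k \<noteq> 0" using v(1,2) by (auto simp: vec_eq_iff)
  define \<mu> where "\<mu> = Max ((\<lambda>i. cmod (v $ i)) ` {..<L})"
  have fin: "finite ((\<lambda>i. cmod (v $ i)) ` {..<L})" "(\<lambda>i. cmod (v $ i)) ` {..<L} \<noteq> {}"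
    using k by auto
  obtain m where m: "m < L" "cmod (v $ m) = \<mu>" using Max_in[OF fin] by (auto simp: \<mu>_def)
  have le: "cmod (v $ j) \<le> \<mu>" if "j < L" for j
    unfolding \<mu>_def using fin that by (intro Max_ge) auto
  have pos: "\<mu> > 0" using le[OF k(1)] k(2) by (meson less_le_trans zero_less_norm_iff)
  have "z * v $ m = (\<Sum>j<L. ?K $$ (m, j) * v $ j)"
    using arg_cong[OF v(3), of "\<lambda>w. w $ m"] m(1) v(1) K
    by (simp add: scalar_prod_def lessThan_atLeast0)
  then have "cmod z * \<mu> = cmod (\<Sum>j<L. ?K $$ (m, j) * v $ j)"
    by (metis m(2) norm_mult)
  also have "\<dots> \<le> (\<Sum>j<L. \<bar>K $$ (m, j)\<bar> * \<mu>)"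
    using K m le by (intro order.trans[OF norm_sum] sum_mono) (auto simp: norm_mult intro: mult_left_mono)
  also have "\<dots> < (\<Sum>j<L. \<mu> / real L)"
    using small[OF m(1)] m(1) pos by (intro sum_strict_mono) (auto simp: field_simps)
  also have "\<dots> = \<mu>" using m(1) by simp
  finally show ?thesis using pos by simp
qed

text \<open>With \<open>G = K / z\<close>, the determinant of \<open>I - G\<close> is the characteristic polynomial of \<open>K\<close>
  divided by \<open>z\<^sup>L\<close>.\<close>

lemma closed_loop_proper_stable:
  fixes K :: "real mat"
  assumes K: "K \<in> carrier_mat L L"
    and small: "\<And>i j. i < L \<Longrightarrow> j < L \<Longrightarrow> real L * \<bar>K $$ (i, j)\<bar> < 1"
    and G: "G = map_mat (\<lambda>k. Fract [:k:] [:0, 1:]) K"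
  shows "det (1\<^sub>m L - G) \<noteq> 0"
    and "i < L \<Longrightarrow> j < L \<Longrightarrow> proper_stable (closed_loop G $$ (i, j))"
proof -
  let ?A = "1\<^sub>m L - G" and ?z = "to_fract [:0, 1 :: real:]"
  have carr: "G \<in> carrier_mat L L" "?A \<in> carrier_mat L L" using K G by auto
  have deg: "degree (char_poly K) = L" "char_poly K \<noteq> 0"
    using degree_monic_char_poly[OF K] by auto
  interpret to_fract: comm_ring_hom "to_fract :: real poly \<Rightarrow> ratfun"
    by unfold_locales auto
  have "?z \<cdot>\<^sub>m ?A = map_mat to_fract (char_poly_matrix K)"
  proof (rule eq_matI)
    fix i j assume "i < dim_row (map_mat to_fract (char_poly_matrix K))"
      "j < dim_col (map_mat to_fract (char_poly_matrix K))"
    then have ij: "i < L" "j < L" using K by (auto simp: char_poly_matrix_def)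
    have "?z * Fract [:k:] [:0, 1:] = to_fract [:k:]" for k
      by (simp add: to_fract_def eq_fract)
    moreover have "to_fract [:- k:] = - to_fract [:k:]" for k :: real
      by (simp flip: to_fract_uminus)
    moreover have "to_fract (pCons (- k) 1) = ?z - to_fract [:k:]" for k
      by (simp flip: to_fract_diff)
    ultimately show "(?z \<cdot>\<^sub>m ?A) $$ (i, j) = map_mat to_fract (char_poly_matrix K) $$ (i, j)"
      using ij K carr by (auto simp: G char_poly_matrix_def right_diff_distrib)
  qed (use K in \<open>auto simp: char_poly_matrix_def G\<close>)
  then have "?z ^ L * det ?A = to_fract (char_poly K)"
    using det_smult[of ?z ?A] carr to_fract.hom_det[of "char_poly_matrix K"]
    by (simp add: char_poly_def)
  moreover have zL: "?z ^ L = to_fract (monom 1 L)"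
    by (simp add: monom_altdef flip: to_fract.hom_power)
  ultimately have det: "to_fract (monom 1 L) * det ?A = to_fract (char_poly K)" by simp
  then show nz: "det ?A \<noteq> 0" using deg(2) by auto
  \<comment> \<open>Numerator and denominator both have degree \<open>L\<close>, and the roots of
    the denominator are eigenvalues of \<open>K\<close>.\<close>
  have "inverse (det ?A) = Fract (monom 1 L) (char_poly K)"
    using det deg(2) nz by (auto simp: Fract_conv_to_fract field_simps)
  then have inv: "proper_stable (inverse (det ?A))"
    unfolding proper_stable_def using deg char_poly_roots_small[OF K small]
    by (intro exI[of _ "monom 1 L"] exI[of _ "char_poly K"]) (auto simp: degree_monom_eq)
  \<comment> \<open>Cramer's rule: the cofactors are polynomials in the entries of
    \<open>I - G\<close>, whose only possible pole is 0.\<close>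
  let ?T = "inverse (det ?A) \<cdot>\<^sub>m adj_mat ?A"
  have T: "?T \<in> carrier_mat L L" "?T * ?A = 1\<^sub>m L"
    using adj_mat[OF carr(2)] carr nz by (auto intro!: eq_matI simp: mult_smult_assoc_mat)
  have entry: "proper_stable (?A $$ (i, j))" if "i < L" "j < L" for i j
  proof -
    have "proper_stable (Fract [:k:] [:0, 1:])" for k :: real
      unfolding proper_stable_def
      by (intro exI[of _ "[:k:]"] exI[of _ "[:0, 1:]"]) (auto simp: map_poly_pCons)
    then show ?thesis
      using that carr K
      by (auto simp: G intro!: proper_stable_diff proper_stable_0 proper_stable_1)
  qed
  assume ij: "i < L" "j < L"
  have "proper_stable (cofactor ?A j i)"
    unfolding cofactor_def
  proof (rule proper_stable_mult)
    show "proper_stable ((- 1) ^ (j + i))"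
      using proper_stable_prod[of "{..<j + i}" "\<lambda>_. -1"] proper_stable_minus[OF proper_stable_1]
      by simp
    show "proper_stable (det (mat_delete ?A j i))"
      using ij carr entry
      by (intro proper_stable_det[OF mat_delete_carrier[OF carr(2)]])
        (auto simp: mat_delete_def simp del: index_minus_mat)
  qed
  then show "proper_stable (closed_loop G $$ (i, j))"
    using closed_loop_eqI(2)[OF carr(1) T] ij carr inv
    by (auto simp: adj_mat_def intro: proper_stable_mult)
qed

section \<open>Necessity\<close>

text \<open>The contrapositive, by transversals. It covers every consistent matrix, not only a
  generic one, which is what makes a failure of identifiability persist on a set of positive
  measure.\<close>

lemma nontrivial_kernel_if_no_linking:
  assumes D: "pverts D = {..<L}" and G: "G \<in> carrier_mat L L" "consistent D G"
    and no: "\<nexists>\<tau>. linking D N B \<tau>"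
  shows "\<exists>x \<in> carrier_vec L. x \<noteq> 0\<^sub>v L \<and> (\<forall>c \<in> B. c < L \<longrightarrow> x $ c = 0) \<and>
    (\<forall>v<L. v \<notin> N \<longrightarrow> ((1\<^sub>m L - G) *\<^sub>v x) $ v = 0)"
proof (rule ccontr)
  assume trivial: "\<not> ?thesis"
  let ?A = "1\<^sub>m L - G"
  have A: "?A \<in> carrier_mat L L" using G by auto
  \<comment> \<open>The rows \<open>Inl c\<close> express that \<open>x\<close> vanishes on
    \<open>B\<close>; the rows \<open>Inr v\<close> are rows of \<open>I - G\<close>.\<close>
  define W where "W r j = (case r of Inl c \<Rightarrow> if c = j then 1 else 0 | Inr v \<Rightarrow> ?A $$ (v, j))"
    for r :: "nat + nat" and j
  define R where "R = Inl ` (B \<inter> {..<L}) \<union> Inr ` ({..<L} - N)"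
  have "\<forall>j<L. x j = 0" if x: "\<forall>r\<in>R. (\<Sum>j<L. W r j * x j) = 0" for x
  proof -
    have "vec L x $ c = 0" if "c \<in> B" "c < L" for c
    proof -
      have "(\<Sum>j<L. W (Inl c) j * x j) = (\<Sum>j<L. if c = j then x j else 0)"
        by (rule sum.cong) (auto simp: W_def)
      moreover have "Inl c \<in> R" using that by (simp add: R_def)
      ultimately show ?thesis using x that by force
    qed
    moreover have "(?A *\<^sub>v vec L x) $ v = 0" if "v < L" "v \<notin> N" for v
    proof -
      have "(?A *\<^sub>v vec L x) $ v = (\<Sum>j<L. W (Inr v) j * x j)"
        using that G A unfolding W_def
        by (auto simp: scalar_prod_def lessThan_atLeast0 intro!: sum.cong)
      then show ?thesis using x that by (auto simp: R_def)
    qed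
    ultimately have "vec L x = 0\<^sub>v L" using trivial by auto
    then show ?thesis by (metis index_vec index_zero_vec(1))
  qed
  from exists_nonzero_transversal[OF this]
  obtain \<sigma> where \<sigma>: "inj_on \<sigma> {..<L}" "\<And>j. j < L \<Longrightarrow> \<sigma> j \<in> R" "\<And>j. j < L \<Longrightarrow> W (\<sigma> j) j \<noteq> 0"
    by blast
  \<comment> \<open>A row \<open>Inl c\<close> is nonzero only in column \<open>c\<close>, which
    belongs to \<open>B\<close>, so columns outside \<open>B\<close> are matched with rows of
    \<open>I - G\<close>.\<close>
  have "\<exists>v. v < L \<and> v \<notin> N \<and> \<sigma> j = Inr v" if "j < L" "j \<notin> B" for j
    using \<sigma>(2,3)[OF that(1)] that(2) by (auto simp: R_def W_def split: if_splits)
  then obtain \<tau> where \<tau>: "\<And>j. j < L \<Longrightarrow> j \<notin> B \<Longrightarrow> \<tau> j < L \<and> \<tau> j \<notin> N \<and> \<sigma> j = Inr (\<tau> j)"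
    by metis
  have "linking D N B \<tau>"
    unfolding linking_def D
  proof (intro conjI ballI)
    show "inj_on \<tau> ({..<L} - B)"
    proof (rule inj_onI)
      fix u v assume uv: "u \<in> {..<L} - B" "v \<in> {..<L} - B" "\<tau> u = \<tau> v"
      then have "\<sigma> u = \<sigma> v" using \<tau>[of u] \<tau>[of v] by auto
      then show "u = v" using inj_onD[OF \<sigma>(1), of u v] uv by auto
    qed
    show "\<tau> ` ({..<L} - B) \<subseteq> {..<L} - N" using \<tau> by auto
    fix u assume u: "u \<in> {..<L} - B"
    then have "?A $$ (\<tau> u, u) \<noteq> 0" using \<sigma>(3)[of u] \<tau>[of u] by (simp add: W_def)
    then show "\<tau> u = u \<or> (u, \<tau> u) \<in> parcs D"
      using u \<tau>[of u] G by (cases "\<tau> u = u") (auto simp: consistent_def)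
  qed
  then show False using no by blast
qed

text \<open>Clear all denominators, then divide by a large power of \<open>z\<close>. A kernel
  vector rescaled this way stays in the kernel, has no pole but 0 and vanishes at infinity.\<close>

lemma strictly_proper_multiple:
  fixes x :: "nat \<Rightarrow> ratfun"
  shows "\<exists>s. s \<noteq> 0 \<and> (\<exists>M a. \<forall>j<L. s * x j = Fract (a j) (monom 1 M) \<and> degree (a j) < M)"
proof -
  have "\<exists>n d. d \<noteq> 0 \<and> x j = Fract n d" for j by (cases "x j") auto
  then obtain nu de where x: "\<And>j. de j \<noteq> 0" "\<And>j. x j = Fract (nu j) (de j)" by metis
  define q where "q = (\<Prod>j<L. de j)"
  define a where "a j = nu j * (\<Prod>i\<in>{..<L} - {j}. de i)" for j
  define M where "M = Suc (\<Sum>j<L. degree (a j))"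
  have q: "q \<noteq> 0" using x(1) by (simp add: q_def)
  show ?thesis
  proof (intro exI conjI allI impI)
    show "Fract q (monom 1 M) \<noteq> 0" using q by (simp add: Zero_fract_def eq_fract)
    fix j assume j: "j < L"
    have "q = de j * (\<Prod>i\<in>{..<L} - {j}. de i)"
      unfolding q_def using j by (intro prod.remove) auto
    then show "Fract q (monom 1 M) * x j = Fract (a j) (monom 1 M)"
      using x(1)[of j] by (simp add: x(2) a_def eq_fract algebra_simps)
    show "degree (a j) < M"
      using j member_le_sum[of j "{..<L}" "\<lambda>j. degree (a j)"] by (simp add: M_def)
  qed
qed

text \<open>Adding \<open>(I - G) y / (1 + y\<^sub>i)\<close> to column \<open>i\<close> of \<open>G\<close> adds \<open>y\<close> times row \<open>i\<close> of \<open>T\<close> to the closed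
  loop \<open>T\<close>, so the new closed loop has no new denominators and \<open>C T\<close> is unchanged.\<close>

lemma indistinguishable_network_matrix:
  fixes y :: "ratfun Matrix.vec"
  assumes wf: "pair_digraph D" and C: "C \<in> carrier_mat p L"
    and G: "G \<in> carrier_mat L L" "consistent D G" "det (1\<^sub>m L - G) \<noteq> 0"
      "\<And>u v. u < L \<Longrightarrow> v < L \<Longrightarrow> proper (G $$ (u, v))"
      "\<And>u v. u < L \<Longrightarrow> v < L \<Longrightarrow> proper_stable (closed_loop G $$ (u, v))"
    and i: "i < L"
    and y: "y \<in> carrier_vec L" "y \<noteq> 0\<^sub>v L" "\<And>v. v < L \<Longrightarrow> proper_stable (y $ v)" "C *\<^sub>v y = 0\<^sub>v p"
      "\<And>v. v < L \<Longrightarrow> v \<notin> out_neighbors D i \<Longrightarrow> ((1\<^sub>m L - G) *\<^sub>v y) $ v = 0"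
    and unit: "1 + y $ i \<noteq> 0" "proper (inverse (1 + y $ i))"
  shows "\<exists>G'. network_matrix L G' \<and> consistent D G' \<and> C * closed_loop G = C * closed_loop G' \<and> G \<noteq> G'"
proof -
  let ?A = "1\<^sub>m L - G" and ?T = "closed_loop G"
  \<comment> \<open>\<open>E\<close> is the rank-one matrix with column \<open>i\<close> equal to
    \<open>y\<close>, and \<open>I - F\<close> is the inverse of \<open>I + E\<close> by the
    Sherman-Morrison formula.\<close>
  define E where "E = mat L L (\<lambda>(v, k). if k = i then y $ v else 0)"
  define F where "F = mat L L (\<lambda>(v, k). if k = i then y $ v * inverse (1 + y $ i) else 0)"
  have A: "?A \<in> carrier_mat L L" using G by auto
  have EF: "E \<in> carrier_mat L L" "F \<in> carrier_mat L L" by (auto simp: E_def F_def)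
  note T = closed_loop_inverse[OF G(1,3)]
  have "(1\<^sub>m L + E) * (1\<^sub>m L - F) = 1\<^sub>m L"
  proof (rule eq_matI)
    fix v k assume "v < dim_row (1\<^sub>m L :: ratfun mat)" "k < dim_col (1\<^sub>m L :: ratfun mat)"
    then have vk: "v < L" "k < L" by auto
    have split: "(1\<^sub>m L + E) $$ (v, m) * (1\<^sub>m L - F) $$ (m, k) =
        (if m = v then (1\<^sub>m L - F) $$ (v, k) else 0) + (if m = i then y $ v * (1\<^sub>m L - F) $$ (i, k) else 0)"
      if "m < L" for m
      using that vk EF i by (auto simp: E_def algebra_simps)
    have "((1\<^sub>m L + E) * (1\<^sub>m L - F)) $$ (v, k) =
        (\<Sum>m<L. (1\<^sub>m L + E) $$ (v, m) * (1\<^sub>m L - F) $$ (m, k))"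
      using vk EF by (auto simp: scalar_prod_def lessThan_atLeast0 intro!: sum.cong)
    also have "\<dots> = (1\<^sub>m L - F) $$ (v, k) + y $ v * (1\<^sub>m L - F) $$ (i, k)"
      using vk i by (simp add: split sum.distrib)
    also have "\<dots> = 1\<^sub>m L $$ (v, k)"
    proof -
      have "y $ v = y $ v * ((1 + y $ i) * inverse (1 + y $ i))" using unit(1) by simp
      also have "\<dots> = y $ v * inverse (1 + y $ i) + y $ v * (y $ i * inverse (1 + y $ i))"
        by (simp only: distrib_left distrib_right mult_1_left)
      finally show ?thesis using vk i by (auto simp: F_def right_diff_distrib)
    qed
    finally show "((1\<^sub>m L + E) * (1\<^sub>m L - F)) $$ (v, k) = 1\<^sub>m L $$ (v, k)" .
  qed (use EF in auto)
  note EF1 = this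
  \<comment> \<open>Chosen so that \<open>I - G' = (I - G) (I - F)\<close>, whose inverse is
    \<open>(I + E) T\<close>.\<close>
  define G' where "G' = G + ?A * F"
  define T' where "T' = (1\<^sub>m L + E) * ?T"
  have carr: "G' \<in> carrier_mat L L" "T' \<in> carrier_mat L L" using G EF A T by (auto simp: G'_def T'_def)
  have AF: "(?A * F) $$ (v, k) = (if k = i then (?A *\<^sub>v y) $ v * inverse (1 + y $ i) else 0)"
    if "v < L" "k < L" for v k
    using that EF A y(1)
    by (auto simp: F_def scalar_prod_def sum_distrib_right mult.assoc intro!: sum.cong)
  have F1: "1\<^sub>m L - F \<in> carrier_mat L L" using EF by auto
  have AF1: "?A * (1\<^sub>m L - F) = 1\<^sub>m L - G'"
  proof -
    have "?A * (1\<^sub>m L - F) = ?A * 1\<^sub>m L - ?A * F"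
      by (rule mult_minus_distrib_mat[OF A one_carrier_mat EF(2)])
    also have "\<dots> = 1\<^sub>m L - G'"
      unfolding G'_def right_mult_one_mat[OF A] using G A EF by (intro eq_matI) auto
    finally show ?thesis .
  qed
  have "T' * (1\<^sub>m L - G') = (1\<^sub>m L + E) * (?T * (?A * (1\<^sub>m L - F)))"
    unfolding T'_def AF1[symmetric]
    by (rule assoc_mult_mat[of _ L L _ L _ L]) (use T EF mult_carrier_mat[OF A F1] in auto)
  also have "?T * (?A * (1\<^sub>m L - F)) = 1\<^sub>m L - F"
    using assoc_mult_mat[OF T(1) A F1] left_mult_one_mat[OF F1] T(3) by simp
  finally have T'1: "T' * (1\<^sub>m L - G') = 1\<^sub>m L" using EF1 by simp
  note cl = closed_loop_eqI[OF carr T'1]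
  have "C * E = 0\<^sub>m p L"
  proof (rule eq_matI)
    fix r k assume "r < dim_row (0\<^sub>m p L :: ratfun mat)" "k < dim_col (0\<^sub>m p L :: ratfun mat)"
    then have rk: "r < p" "k < L" by auto
    have "(C *\<^sub>v y) $ r = (\<Sum>m<L. C $$ (r, m) * y $ m)"
      using rk C y(1) by (auto simp: scalar_prod_def lessThan_atLeast0 intro!: sum.cong)
    then have "(\<Sum>m<L. C $$ (r, m) * y $ m) = 0" using y(4) rk by simp
    moreover have "(C * E) $$ (r, k) = (\<Sum>m<L. C $$ (r, m) * (if k = i then y $ m else 0))"
      using rk C by (auto simp: E_def scalar_prod_def lessThan_atLeast0 intro!: sum.cong)
    ultimately show "(C * E) $$ (r, k) = 0\<^sub>m p L $$ (r, k)" using rk by (cases "k = i") auto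
  qed (use C EF in auto)
  then have "C * (1\<^sub>m L + E) = C"
    using mult_add_distrib_mat[OF C one_carrier_mat EF(1)] C by simp
  then have CT: "C * T' = C * ?T"
    using assoc_mult_mat[OF C _ T(1), of "1\<^sub>m L + E"] EF by (simp add: T'_def)
  \<comment> \<open>Only column \<open>i\<close> changes, by a multiple of \<open>(I - G) y\<close>,
    which is supported on the out-neighbors of \<open>i\<close>.\<close>
  have cons: "consistent D G'"
    unfolding consistent_def
  proof (intro allI impI)
    fix v k assume vk: "v < dim_row G'" "k < dim_col G'" "G' $$ (v, k) \<noteq> 0"
    then have "v < L" "k < L" using carr by auto
    then have "G $$ (v, k) \<noteq> 0 \<or> k = i \<and> (?A *\<^sub>v y) $ v \<noteq> 0"
      using vk(3) AF[of v k] G A EF by (auto simp: G'_def split: if_splits)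
    then show "(k, v) \<in> parcs D"
      using G(1,2) \<open>v < L\<close> \<open>k < L\<close> y(5)[of v] by (auto simp: consistent_def out_neighbors_def)
  qed
  have "pair_loopfree_digraph D" using wf by (simp add: pair_digraph_def)
  then have "G' $$ (v, v) = 0" if "v < L" for v
    using cons that carr pair_loopfree_digraph.pair_no_loops[of D "(v, v)"]
    by (auto simp: consistent_def)
  moreover have "proper x" if x: "x \<in> elements_mat G'" for x
  proof -
    obtain v k where vk: "v < L" "k < L" "x = G' $$ (v, k)" using elements_matD[OF x] carr by auto
    have "proper ((?A *\<^sub>v y) $ v)"
    proof -
      have "proper (?A $$ (v, j))" if "j < L" for j
        using that vk(1) G(1,4) by (auto intro: proper_diff proper_minus
          proper_stable_imp_proper[OF proper_stable_1] proper_stable_imp_proper[OF proper_stable_0])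
      then show ?thesis
        using vk(1) A y(1,3)
        by (auto simp: scalar_prod_def simp del: index_minus_mat intro!: proper_sum proper_mult
          intro: proper_stable_imp_proper)
    qed
    then show ?thesis
      using vk AF[OF vk(1,2)] G(1,4) A EF unit(2)
      by (auto simp: G'_def simp del: index_minus_mat
        intro!: proper_add proper_mult proper_stable_imp_proper[OF proper_stable_0])
  qed
  \<comment> \<open>The zeros of \<open>1 + y $ i\<close> are not controlled, but its inverse enters
    only \<open>G'\<close>, where properness suffices; \<open>T'\<close> is free of it.\<close>
  moreover have "well_posed G'"
  proof -
    have "proper_stable (T' $$ (u, v))" if "u < L" "v < L" for u v
      unfolding T'_def
    proof (rule proper_stable_mult_mat[OF _ _ T(1) G(5)])
      show "proper_stable ((1\<^sub>m L + E) $$ (u, v))" if "u < L" "v < L" for u v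
        using that EF y(3) by (auto simp: E_def
            intro!: proper_stable_add proper_stable_0 proper_stable_1)
    qed (use EF that in auto)
    then have "proper_stable x" if "x \<in> elements_mat T'" for x
      using elements_matD[OF that] carr by auto
    then have "\<forall>x \<in> elements_mat T'. proper x \<and> stable x"
      using proper_stable_imp_proper proper_stable_imp_stable by blast
    moreover have "invertible_mat (1\<^sub>m L - G')"
      using cl(1) invertible_mat_iff_det[OF minus_carrier_mat[OF carr(1)]] by blast
    ultimately show ?thesis using cl(2) carr by (simp add: well_posed_def)
  qed
  moreover have "G \<noteq> G'"
  proof
    assume "G = G'"
    then have "?A * F = 0\<^sub>m L L"
    proof (intro eq_matI)
      fix v k assume "v < dim_row (0\<^sub>m L L :: ratfun mat)" "k < dim_col (0\<^sub>m L L :: ratfun mat)"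
      then have "v < L" "k < L" by auto
      then show "(?A * F) $$ (v, k) = 0\<^sub>m L L $$ (v, k)"
        using arg_cong[OF \<open>G = G'\<close>, of "\<lambda>M. M $$ (v, k)"] G(1) A EF by (simp add: G'_def)
    qed (use A EF in auto)
    then have F0: "F = 0\<^sub>m L L"
      using assoc_mult_mat[OF T(1) A EF(2)] T EF by simp
    have "y $ v = 0" if "v < L" for v
      using arg_cong[OF F0, of "\<lambda>M. M $$ (v, i)"] that i unit(1) by (simp add: F_def)
    then have "y = 0\<^sub>v L" using y(1) by (intro eq_vecI) auto
    then show False using y(2) by simp
  qed
  ultimately show ?thesis
    using carr cons CT cl(2) unfolding network_matrix_def by metis
qed

text \<open>One bad parametrization suffices. With entries \<open>\<kappa> / z\<close> the gains are
  the only parameters, and on a small box of positive measure the closed loop is proper and stable,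
  so an indistinguishable network matrix exists at every point of the box.\<close>

lemma not_generically_identifiable_if_no_linking:
  assumes D: "pair_digraph D" "pverts D = {..<L}" and C: "selection_matrix p L C"
    and i: "i < L" and no: "\<nexists>\<tau>. linking D (out_neighbors D i) (measured_nodes C) \<tau>"
  shows "\<not> generically_identifiable L D C"
proof
  assume ident: "generically_identifiable L D C"
  let ?d = "\<lambda>_ _. 1 :: nat" and ?n = "\<lambda>_ _. 0 :: nat"
  let ?I = "param_set D ?n"
  let ?M = "\<Pi>\<^sub>M x \<in> ?I. (lborel :: real measure)"
  \<comment> \<open>Gains of this size keep \<open>L\<close> times each entry of \<open>K\<close>
    below 1 in modulus.\<close>
  define \<epsilon> where "\<epsilon> = 1 / (real L + 1)"
  define box where "box = (\<Pi>\<^sub>E x \<in> ?I. {-\<epsilon>..\<epsilon>})"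
  have \<epsilon>: "\<epsilon> > 0" "real L * \<epsilon> < 1" by (auto simp: \<epsilon>_def field_simps)
  have fin: "finite ?I"
    using D(1) by (intro finite_param_set) (auto simp: pair_digraph_def pair_fin_digraph_def
        pair_fin_digraph_axioms_def)
  interpret product_sigma_finite "\<lambda>_. lborel :: real measure" ..
  have box: "box \<in> sets ?M" unfolding box_def using fin by (intro sets_PiM_I_finite) auto
  have "emeasure ?M box = (\<Prod>x\<in>?I. emeasure lborel {-\<epsilon>..\<epsilon>})"
    unfolding box_def using fin by (intro emeasure_PiM) auto
  then have pos: "emeasure ?M box \<noteq> 0" using \<epsilon>(1) fin by simp
  have "AE P in ?M. \<forall>G. network_matrix L G \<and> consistent D G \<longrightarrow>
      C * closed_loop (param_matrix L D ?d ?n P) = C * closed_loop G \<longrightarrow>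
      param_matrix L D ?d ?n P = G" (is "AE P in ?M. ?Q P")
    using ident unfolding generically_identifiable_def by blast
  \<comment> \<open>A box of positive measure is not contained in a null set.\<close>
  then have "\<exists>P\<in>box. ?Q P"
  proof (rule contrapos_pp)
    assume "\<not> (\<exists>P\<in>box. ?Q P)"
    then have sub: "box \<subseteq> {P \<in> space ?M. \<not> ?Q P}" using sets.sets_into_space[OF box] by blast
    show "\<not> (AE P in ?M. ?Q P)"
    proof
      assume "AE P in ?M. ?Q P"
      then obtain N where N: "{P \<in> space ?M. \<not> ?Q P} \<subseteq> N" "emeasure ?M N = 0" "N \<in> sets ?M"
        by (rule AE_E)
      have "box \<subseteq> N" using sub N(1) by (rule subset_trans)
      from emeasure_mono[OF this N(3)] show False using pos N(2) by simp
    qed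
  qed
  then obtain P where P: "P \<in> box" "?Q P" by blast
  define K where "K = mat L L (\<lambda>(u, v). if (v, u) \<in> parcs D then P (Kappa u v) else 0)"
  have K: "K \<in> carrier_mat L L" by (simp add: K_def)
  have small: "real L * \<bar>K $$ (u, v)\<bar> < 1" if "u < L" "v < L" for u v
  proof -
    have "\<bar>P (Kappa u v)\<bar> \<le> \<epsilon>" if "(v, u) \<in> parcs D"
    proof -
      have "Kappa u v \<in> ?I" using that by (simp add: param_set_def)
      then have "P (Kappa u v) \<in> {-\<epsilon>..\<epsilon>}" using P(1) unfolding box_def by (rule PiE_mem[rotated])
      then show ?thesis by auto
    qed
    then have "\<bar>K $$ (u, v)\<bar> \<le> \<epsilon>" using that \<epsilon>(1) by (auto simp: K_def)
    then show ?thesis using \<epsilon>(2) by (meson mult_left_mono of_nat_0_le_iff le_less_trans)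
  qed
  let ?G = "param_matrix L D ?d ?n P"
  have G: "?G = map_mat (\<lambda>k. Fract [:k:] [:0, 1:]) K"
  proof (rule eq_matI)
    fix u v assume "u < dim_row (map_mat (\<lambda>k. Fract [:k:] [:0, 1:]) K)"
      "v < dim_col (map_mat (\<lambda>k. Fract [:k:] [:0, 1:]) K)"
    then have uv: "u < L" "v < L" using K by auto
    have "monic_poly 0 c = 1" for c by (simp add: monic_poly_def)
    moreover have "monom (1::real) (Suc 0) = [:0, 1:]" by (simp add: monom_Suc)
    ultimately show "?G $$ (u, v) = map_mat (\<lambda>k. Fract [:k:] [:0, 1:]) K $$ (u, v)"
      using uv by (simp add: K_def param_matrix_def param_entry_def fract_collapse)
  qed (use K in \<open>auto simp: param_matrix_def\<close>)
  note carr = param_matrix_carrier[of L D ?d ?n P]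
  note cons = consistent_param_matrix[of D L ?d ?n P]
  note cl = closed_loop_proper_stable[OF K small G]
  obtain x where x: "x \<in> carrier_vec L" "x \<noteq> 0\<^sub>v L"
      "\<And>c. c \<in> measured_nodes C \<Longrightarrow> c < L \<Longrightarrow> x $ c = 0"
      "\<And>v. v < L \<Longrightarrow> v \<notin> out_neighbors D i \<Longrightarrow> ((1\<^sub>m L - ?G) *\<^sub>v x) $ v = 0"
    using nontrivial_kernel_if_no_linking[OF D(2) carr cons no] by blast
  obtain s M a where s: "s \<noteq> 0" "\<And>j. j < L \<Longrightarrow> s * x $ j = Fract (a j) (monom 1 M)"
      "\<And>j. j < L \<Longrightarrow> degree (a j) < M"
    using strictly_proper_multiple[of L "\<lambda>j. x $ j"] by blast
  \<comment> \<open>The kernel conditions are linear over the field of rational functions, so they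
    survive multiplication by \<open>s\<close>.\<close>
  define y where "y = s \<cdot>\<^sub>v x"
  have y: "y \<in> carrier_vec L" using x(1) by (simp add: y_def)
  have y_nth: "y $ j = Fract (a j) (monom 1 M)" if "j < L" for j
    using s(2)[OF that] that x(1) by (simp add: y_def)
  have "M > 0" using s(3)[OF i] by simp
  have y_good: "proper_stable (y $ j)" if "j < L" for j
    unfolding proper_stable_def y_nth[OF that] using s(3)[OF that] \<open>M > 0\<close>
    by (intro exI[of _ "a j"] exI[of _ "monom 1 M"])
      (auto simp: degree_monom_eq map_poly_monom poly_monom)
  have y_nz: "y \<noteq> 0\<^sub>v L"
  proof
    assume y0: "y = 0\<^sub>v L"
    have "x $ j = 0" if "j < L" for j
      using arg_cong[OF y0, of "\<lambda>w. w $ j"] that s(1) x(1) by (simp add: y_def)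
    then have "x = 0\<^sub>v L" using x(1) by (intro eq_vecI) auto
    then show False using x(2) by simp
  qed
  have Cc: "C \<in> carrier_mat p L" using C by (simp add: selection_matrix_def)
  have "\<forall>c \<in> measured_nodes C. y $ c = 0"
    using x(1,3) Cc by (auto simp: y_def measured_nodes_def)
  then have Cy: "C *\<^sub>v y = 0\<^sub>v p" using selection_mult_vec_eq_0_iff[OF C y] by simp
  have A: "1\<^sub>m L - ?G \<in> carrier_mat L L" using carr by (rule minus_carrier_mat)
  have Ay: "((1\<^sub>m L - ?G) *\<^sub>v y) $ v = 0" if "v < L" "v \<notin> out_neighbors D i" for v
  proof -
    have "(1\<^sub>m L - ?G) *\<^sub>v y = s \<cdot>\<^sub>v ((1\<^sub>m L - ?G) *\<^sub>v x)"
      unfolding y_def using A x(1) by (rule mult_mat_vec)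
    then show ?thesis using x(4)[OF that] that(1) carr by (simp del: index_mult_mat_vec)
  qed
  \<comment> \<open>The numerator of \<open>1 + y $ i\<close>. Since \<open>y $ i\<close> is
    strictly proper, \<open>b\<close> has the same degree as the denominator, so the inverse is
    proper.\<close>
  define b where "b = monom 1 M + a i"
  have "degree b = M"
    unfolding b_def using s(3)[OF i] by (subst degree_add_eq_left) (auto simp: degree_monom_eq)
  then have b: "degree b = M" "b \<noteq> 0" using \<open>M > 0\<close> by auto
  have unit: "1 + y $ i = Fract b (monom 1 M)"
    unfolding y_nth[OF i] b_def by (simp add: One_fract_def eq_fract algebra_simps)
  have "1 + y $ i \<noteq> 0" unfolding unit using b(2) by (simp add: Zero_fract_def eq_fract)
  moreover have "proper (inverse (1 + y $ i))"
    unfolding unit inverse_fract proper_def using b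
    by (intro exI[of _ "monom 1 M"] exI[of _ b]) (auto simp: degree_monom_eq)
  moreover have "proper (?G $$ (u, v))" if "u < L" "v < L" for u v
    unfolding G proper_def using that K
    by (intro exI[of _ "[:K $$ (u, v):]"] exI[of _ "[:0, 1:]"]) auto
  ultimately obtain G' where "network_matrix L G'" "consistent D G'"
      "C * closed_loop ?G = C * closed_loop G'" "?G \<noteq> G'"
    using indistinguishable_network_matrix[OF D(1) Cc carr cons cl(1) _ cl(2) i y y_nz y_good Cy Ay]
    by blast
  then show False using P(2) by blast
qed

theorem mainTheorem3:
  fixes L p :: nat
    and D :: "nat pair_pre_digraph"
    and G0 C :: "ratfun mat"
  assumes "network_graph L D"
    and "network_matrix L G0"
    and "consistent D G0"
    and "selection_matrix p L C"
    and "card (measured_nodes C) = p"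
  shows "generically_identifiable L D C \<longleftrightarrow>
    (\<forall>i < L. max_disjoint_paths D (out_neighbors D i) (measured_nodes C) = card (out_neighbors D i))"
proof -
  have D: "pair_digraph D" "pverts D = {..<L}" using assms(1) by (auto simp: network_graph_def)
  then interpret pair_digraph D by simp
  have N: "out_neighbors D i \<subseteq> pverts D" for i by (auto simp: out_neighbors_def dest: in_arcsD2)
  then have fin: "finite (out_neighbors D i)" for i using finite_subset pair_finite_verts by blast
  show ?thesis
  proof (intro iffI allI impI)
    fix i assume "generically_identifiable L D C" "i < L"
    then obtain \<tau> where "linking D (out_neighbors D i) (measured_nodes C) \<tau>"
      using not_generically_identifiable_if_no_linking[OF D assms(4)] by blast
    then show "max_disjoint_paths D (out_neighbors D i) (measured_nodes C) = card (out_neighbors D i)"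
      using linking_imp_disjoint_paths[OF pair_finite_verts N]
      by (simp add: max_disjoint_paths_eq_card_iff[OF fin])
  next
    assume max: "\<forall>i<L. max_disjoint_paths D (out_neighbors D i) (measured_nodes C) =
      card (out_neighbors D i)"
    show "generically_identifiable L D C"
    proof (rule generically_identifiable_if_linkings[OF pair_finite_arcs D(2) assms(4)])
      fix i assume "i < L"
      then obtain Q where "disjoint_paths D (out_neighbors D i) (measured_nodes C) Q"
          "card Q = card (out_neighbors D i)"
        using max by (auto simp: max_disjoint_paths_eq_card_iff[OF fin])
      \<comment> \<open>A linking that contains cycles admits no decreasing rank; one built from
        paths does, which the generic kernel argument relies on.\<close>
      then show "\<exists>\<tau> (h :: nat \<Rightarrow> nat). linking D (out_neighbors D i) (measured_nodes C) \<tau> \<and>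
          (\<forall>u \<in> pverts D - measured_nodes C. \<tau> u \<noteq> u \<longrightarrow> h (\<tau> u) < h u)"
        by (intro disjoint_paths_imp_linking[OF pair_wf_digraph_axioms fin N])
    qed
  qed
qed

end
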